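(* Let $G$ be a GBS group represented by a connected labelled graph $\Gamma$. Then: (1) every standard generating set of $G$ (associated to $\Gamma$ and a maximal subtree of $\Gamma$) contains a generating set of $G$ of cardinality $\mathrm{rk}(G)$; (2) $\mathrm{rk}(G)=\beta(\Gamma)+\mu(\Gamma)$, where $\beta(\Gamma)$ is the first Betti number of $\Gamma$ and $\mu(\Gamma)$ is its plateaunic number.
   Context: The rank $\mathrm{rk}(G)$ is the minimal cardinality of a generating set of $G$. A labelled graph is a finite graph $\Gamma$ (loops and multiple edges allowed) in which each oriented edge $e$ carries a label $\lambda_e$, a nonzero integer (possibly negative). We denote by $o(e)$ the origin of $e$ and by $\tilde e$ the edge $e$ with the opposite orientation. A connected labelled graph defines a graph of groups in which all vertex and edge groups are $\mathbb{Z}$ and the inclusion from the edge group $G_e$ (with $G_e=G_{\tilde e}$) into the vertex group $G_{o(e)}$ is multiplication by $\lambda_e$. The fundamental group $G$ of this graph of groups is the generalized Baumslag-Solitar (GBS) group represented by $\Gamma$. Let $V$ be the vertex set of $\Gamma$, and let $\Gamma_0\subset\Gamma$ be a maximal subtree. Let $\mathcal{E}_0$ be the set of non-oriented edges $\varepsilon=(e,\tilde e)$ not in $\Gamma_0$. The associated standard presentation of $G$ has one generator $a_v$ (generating the vertex group $G_v$) for each $v\in V$, one generator $t_\varepsilon$ for each $\varepsilon\in\mathcal{E}_0$, and one relation for each non-oriented edge $\varepsilon=(e,\tilde e)$ of $\Gamma$: $(a_{o(e)})^{\lambda_e}=(a_{o(\tilde e)})^{\lambda_{\tilde e}}$ if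 $\varepsilon\subset\Gamma_0$, and $t_\varepsilon (a_{o(e)})^{\lambda_e}t_\varepsilon^{-1}=(a_{o(\tilde e)})^{\lambda_{\tilde e}}$ if $\varepsilon\not\subset\Gamma_0$. The set $\{(a_v)_{v\in V},(t_\varepsilon)_{\varepsilon\in\mathcal{E}_0}\}$ is called a standard generating set. Let $p$ be a prime. A non-empty connected subgraph $P\subset\Gamma$ is a $p$-plateau if for every oriented edge $e$ of $\Gamma$ with $o(e)\in P$: the label $\lambda_e$ is divisible by $p$ if and only if $e$ is not contained in $P$. A plateau is a subgraph that is a $p$-plateau for some prime $p$ (possibly $\Gamma$ itself). The plateaunic number $\mu(\Gamma)$ is the minimal cardinality of a set of vertices of $\Gamma$ meeting every plateau. *)

theory Defs
  imports
    "Graph_Theory.Graph_Theory"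
    "HOL-Algebra.Elementary_Groups"
    "HOL-Library.Function_Algebras"
    "HOL-Computational_Algebra.Primes"
begin

section \<open>Rank of a group\<close>

text \<open>For a group that is not finitely generated the value of \<open>group_rank\<close> is unspecified.\<close>

definition group_rank :: "('g, 'm) monoid_scheme \<Rightarrow> nat" where
  "group_rank G = (LEAST n. \<exists>S. S \<subseteq> carrier G \<and> finite S \<and> card S = n \<and> generate G S = carrier G)"


section \<open>Graphs\<close>

text \<open>
  Graphs are taken in the sense of Serre: \<^locale>\<open>bidirected_digraph\<close>. The arcs are the
  oriented edges, \<open>arev\<close> is the fixed-point-free reversal of orientation (a loop gives two distinct
  arcs as well), and \<open>tail\<close> is the origin. A subgraph must be closed under reversal.
\<close>

context bidirected_digraph begin

definition serre_subgraph :: "('a, 'b) pre_digraph \<Rightarrow> bool" where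
  "serre_subgraph H \<longleftrightarrow> subgraph H G \<and> (\<forall>e\<in>arcs H. arev e \<in> arcs H)"

text \<open>
  The library's \<^const>\<open>tree\<close> is about directed cycles, so it also excludes the backtracking
  \<open>[e, arev e]\<close>, which is not a circuit of the undirected graph.
\<close>

definition subtree :: "('a, 'b) pre_digraph \<Rightarrow> bool" where
  "subtree H \<longleftrightarrow> serre_subgraph H \<and> Digraph_Component.connected H
     \<and> (\<forall>p. pre_digraph.cycle H p \<longrightarrow> (\<exists>e. p = [e, arev e]))"

definition maximal_subtree :: "('a, 'b) pre_digraph \<Rightarrow> bool" where
  "maximal_subtree H \<longleftrightarrow> max_subgraph subtree H"

text \<open>
  One-dimensional rational cycles. A chain is an antisymmetric function on the oriented edges (an
  edge and its reverse are opposite generators of \<open>C\<^sub>1\<close>), and the coefficient of its boundary at \<open>v\<close>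
  is minus the sum over all oriented edges with origin \<open>v\<close>. A graph has no 2-cells, so
  this space is \<open>H\<^sub>1\<close> with rational coefficients.
\<close>

definition cycle_space :: "('b \<Rightarrow> rat) set" where
  "cycle_space = {f. (\<forall>e. e \<notin> arcs G \<longrightarrow> f e = 0) \<and> (\<forall>e\<in>arcs G. f (arev e) = - f e)
     \<and> (\<forall>v\<in>verts G. (\<Sum>e\<in>out_arcs G v. f e) = 0)}"

definition first_betti_number :: nat where
  "first_betti_number = vector_space.dim (\<lambda>(c::rat) f e. c * f e) cycle_space"

end

lemma vector_space_rat_fun: "vector_space (\<lambda>(c::rat) f (e::'b). c * f e)"
  by (rule vector_space.intro) (simp_all only: fun_eq_iff plus_fun_apply distrib_left distrib_right mult.assoc mult_1_left simp_thms)


section \<open>Graphs of groups and their fundamental groups\<close>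

locale graph_of_groups = bidirected_digraph G arev
  for G :: "('v, 'e) pre_digraph" and arev :: "'e \<Rightarrow> 'e" +
  fixes vgrp :: "'v \<Rightarrow> 'a monoid"
    and egrp :: "'e \<Rightarrow> 'b monoid"
    and incl :: "'e \<Rightarrow> 'b \<Rightarrow> 'a"
  assumes group_vgrp: "v \<in> verts G \<Longrightarrow> group (vgrp v)"
    and group_egrp: "e \<in> arcs G \<Longrightarrow> group (egrp e)"
    and egrp_arev: "e \<in> arcs G \<Longrightarrow> egrp (arev e) = egrp e"
    and incl_hom: "e \<in> arcs G \<Longrightarrow> incl e \<in> hom (egrp e) (vgrp (tail G e))"
    and incl_inj: "e \<in> arcs G \<Longrightarrow> inj_on (incl e) (carrier (egrp e))"

datatype ('v, 'e, 'a) letter = Elt 'v 'a | Edge 'e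

context graph_of_groups begin

fun valid_letter :: "('v, 'e, 'a) letter \<Rightarrow> bool" where
  "valid_letter (Elt v g) \<longleftrightarrow> v \<in> verts G \<and> g \<in> carrier (vgrp v)"
| "valid_letter (Edge e) \<longleftrightarrow> e \<in> arcs G"

definition gwords :: "('v, 'e, 'a) letter list set" where
  "gwords = {w. \<forall>x\<in>set w. valid_letter x}"

text \<open>
  The fundamental group relative to a maximal subtree \<open>T\<close> (Serre): it is generated by the vertex
  groups and one element for each oriented edge, subject to the relations
  \<open>elt_mult\<close> to \<open>tree_edge\<close> below. Formal inverses of the generators are not needed, because
  \<open>Elt v (inv g)\<close> and \<open>Edge (arev e)\<close> play their role, so the group is a quotient of the
  monoid of words by the congruence generated by these relations.
\<close>

inductive word_eq ::
    "('v, 'e) pre_digraph \<Rightarrow> ('v, 'e, 'a) letter list \<Rightarrow> ('v, 'e, 'a) letter list \<Rightarrow> bool"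
  for T where
  refl: "word_eq T w w"
| sym: "word_eq T w w' \<Longrightarrow> word_eq T w' w"
| trans: "word_eq T w w' \<Longrightarrow> word_eq T w' w'' \<Longrightarrow> word_eq T w w''"
| in_ctxt: "word_eq T w w' \<Longrightarrow> word_eq T (u @ w @ u') (u @ w' @ u')"
| elt_mult: "\<lbrakk>v \<in> verts G; g \<in> carrier (vgrp v); h \<in> carrier (vgrp v)\<rbrakk> \<Longrightarrow>
    word_eq T [Elt v g, Elt v h] [Elt v (g \<otimes>\<^bsub>vgrp v\<^esub> h)]"
| elt_one: "v \<in> verts G \<Longrightarrow> word_eq T [Elt v \<one>\<^bsub>vgrp v\<^esub>] []"
| edge_inv: "e \<in> arcs G \<Longrightarrow> word_eq T [Edge e, Edge (arev e)] []"
| edge_conj: "\<lbrakk>e \<in> arcs G; c \<in> carrier (egrp e)\<rbrakk> \<Longrightarrow>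
    word_eq T [Edge e, Elt (tail G e) (incl e c), Edge (arev e)]
              [Elt (tail G (arev e)) (incl (arev e) c)]"
| tree_edge: "e \<in> arcs T \<Longrightarrow> word_eq T [Edge e] []"

definition word_class ::
    "('v, 'e) pre_digraph \<Rightarrow> ('v, 'e, 'a) letter list \<Rightarrow> ('v, 'e, 'a) letter list set" where
  "word_class T w = {w'. word_eq T w w'}"

definition fundamental_group :: "('v, 'e) pre_digraph \<Rightarrow> ('v, 'e, 'a) letter list set monoid" where
  "fundamental_group T =
     \<lparr>carrier = word_class T ` gwords,
      mult = (\<lambda>A B. \<Union>w\<in>A. \<Union>w'\<in>B. word_class T (w @ w')),
      one = word_class T []\<rparr>"

lemma word_class_eq_iff: "word_class T w = word_class T w' \<longleftrightarrow> word_eq T w w'"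
proof
  assume "word_class T w = word_class T w'"
  moreover have "w' \<in> word_class T w'" by (simp add: word_class_def word_eq.refl)
  ultimately have "w' \<in> word_class T w" by blast
  then show "word_eq T w w'" by (simp add: word_class_def)
next
  assume "word_eq T w w'"
  then show "word_class T w = word_class T w'"
    using word_eq.trans[of T w w'] word_eq.trans[OF word_eq.sym, of T w w']
    unfolding word_class_def by blast
qed

lemma word_eq_append:
  assumes "word_eq T w w'" "word_eq T u u'"
  shows "word_eq T (w @ u) (w' @ u')"
proof (rule word_eq.trans)
  show "word_eq T (w @ u) (w' @ u)" using word_eq.in_ctxt[OF assms(1), of "[]" u] by simp
  show "word_eq T (w' @ u) (w' @ u')" using word_eq.in_ctxt[OF assms(2), of w' "[]"] by simp
qed

lemma mult_word_class:
  "word_class T w \<otimes>\<^bsub>fundamental_group T\<^esub> word_class T w' = word_class T (w @ w')"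
proof -
  have "word_class T (x @ y) = word_class T (w @ w')"
    if "x \<in> word_class T w" "y \<in> word_class T w'" for x y
  proof -
    have "word_eq T w x" "word_eq T w' y" using that by (simp_all add: word_class_def)
    then have "word_eq T (w @ w') (x @ y)" by (rule word_eq_append)
    then show ?thesis using word_class_eq_iff by metis
  qed
  moreover have "w \<in> word_class T w" "w' \<in> word_class T w'"
    by (auto simp: word_class_def intro: word_eq.refl)
  ultimately have "(\<Union>x\<in>word_class T w. \<Union>y\<in>word_class T w'. word_class T (x @ y)) = word_class T (w @ w')"
    by blast
  then show ?thesis by (simp add: fundamental_group_def)
qed

lemma one_fundamental_group: "\<one>\<^bsub>fundamental_group T\<^esub> = word_class T []"
  by (simp add: fundamental_group_def)

lemma carrier_fundamental_group: "carrier (fundamental_group T) = word_class T ` gwords"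
  by (simp add: fundamental_group_def)

lemma left_inverse_word:
  "w \<in> gwords \<Longrightarrow> \<exists>u\<in>gwords. word_eq T (u @ w) []"
proof (induction w)
  case Nil
  have "[] \<in> gwords" by (simp add: gwords_def)
  moreover have "word_eq T ([] @ []) []" by (simp add: word_eq.refl)
  ultimately show ?case by (rule bexI[rotated])
next
  case (Cons x w)
  then have x: "valid_letter x" and "w \<in> gwords" by (simp_all add: gwords_def)
  then obtain u where u: "u \<in> gwords" "word_eq T (u @ w) []" using Cons.IH by blast
  have "\<exists>y. valid_letter y \<and> word_eq T [y, x] []"
  proof (cases x)
    case (Elt v g)
    with x have v: "v \<in> verts G" and g: "g \<in> carrier (vgrp v)" by auto
    interpret group "vgrp v" by (rule group_vgrp[OF v])
    have "word_eq T [Elt v (inv\<^bsub>vgrp v\<^esub> g), Elt v g] []"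
    proof (rule word_eq.trans)
      show "word_eq T [Elt v (inv\<^bsub>vgrp v\<^esub> g), Elt v g] [Elt v \<one>\<^bsub>vgrp v\<^esub>]"
        using word_eq.elt_mult[OF v inv_closed[OF g] g, of T] g by simp
    qed (rule word_eq.elt_one[OF v])
    moreover have "valid_letter (Elt v (inv\<^bsub>vgrp v\<^esub> g))" using v g by simp
    ultimately show ?thesis unfolding Elt by blast
  next
    case (Edge e)
    with x have e: "arev e \<in> arcs G" by simp
    then have "word_eq T [Edge (arev e), Edge e] []" using word_eq.edge_inv[OF e, of T] by simp
    moreover have "valid_letter (Edge (arev e))" using e by simp
    ultimately show ?thesis unfolding Edge by blast
  qed
  then obtain y where y: "valid_letter y" "word_eq T [y, x] []" by blast
  have "word_eq T (u @ [y, x] @ w) (u @ [] @ w)" by (rule word_eq.in_ctxt[OF y(2)])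
  then have "word_eq T ((u @ [y]) @ x # w) (u @ w)" by simp
  then have "word_eq T ((u @ [y]) @ x # w) []" by (rule word_eq.trans) (rule u(2))
  moreover have "u @ [y] \<in> gwords" using u(1) y(1) by (auto simp: gwords_def)
  ultimately show ?case by blast
qed

lemma group_fundamental_group: "group (fundamental_group T)"
proof (rule groupI)
  fix x y assume "x \<in> carrier (fundamental_group T)" "y \<in> carrier (fundamental_group T)"
  then obtain w w' where "x = word_class T w" "y = word_class T w'" "w \<in> gwords" "w' \<in> gwords"
    by (auto simp: carrier_fundamental_group)
  moreover from this have "w @ w' \<in> gwords" by (auto simp: gwords_def)
  ultimately show "x \<otimes>\<^bsub>fundamental_group T\<^esub> y \<in> carrier (fundamental_group T)"
    by (simp add: mult_word_class) (simp add: carrier_fundamental_group)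
next
  show "\<one>\<^bsub>fundamental_group T\<^esub> \<in> carrier (fundamental_group T)"
    by (simp add: one_fundamental_group carrier_fundamental_group gwords_def)
next
  fix x assume "x \<in> carrier (fundamental_group T)"
  then obtain w where x: "x = word_class T w" and w: "w \<in> gwords"
    by (auto simp: carrier_fundamental_group)
  obtain u where "u \<in> gwords" "word_eq T (u @ w) []" using left_inverse_word[OF w] by blast
  then show "\<exists>y\<in>carrier (fundamental_group T). y \<otimes>\<^bsub>fundamental_group T\<^esub> x = \<one>\<^bsub>fundamental_group T\<^esub>"
    by (intro bexI[of _ "word_class T u"])
      (auto simp: x mult_word_class one_fundamental_group carrier_fundamental_group word_class_eq_iff)
qed (auto simp: carrier_fundamental_group one_fundamental_group mult_word_class)

end


section \<open>Labelled graphs and generalized Baumslag-Solitar groups\<close>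

locale labelled_graph = bidirected_digraph G arev + fin_digraph G
  for G :: "('v, 'e) pre_digraph" and arev :: "'e \<Rightarrow> 'e" +
  fixes lab :: "'e \<Rightarrow> int"
  assumes lab_nonzero: "e \<in> arcs G \<Longrightarrow> lab e \<noteq> 0"

sublocale labelled_graph \<subseteq>
  graph_of_groups G arev "\<lambda>_. integer_group" "\<lambda>_. integer_group" "\<lambda>e n. lab e * n"
  by (intro graph_of_groups.intro graph_of_groups_axioms.intro bidirected_digraph_axioms)
    (auto simp: hom_def inj_on_def algebra_simps lab_nonzero)

context labelled_graph begin

definition vertex_gen :: "('v, 'e) pre_digraph \<Rightarrow> 'v \<Rightarrow> ('v, 'e, int) letter list set" where
  "vertex_gen T v = word_class T [Elt v 1]"

definition stable_letter :: "('v, 'e) pre_digraph \<Rightarrow> 'e \<Rightarrow> ('v, 'e, int) letter list set" where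
  "stable_letter T e = word_class T [Edge e]"

text \<open>
  The fundamental groups relative to different maximal subtrees are isomorphic, and the group
  represented by the labelled graph is this group, up to isomorphism.
\<close>

definition represents_gbs :: "('g, 'm) monoid_scheme \<Rightarrow> bool" where
  "represents_gbs H \<longleftrightarrow> group H \<and> (\<exists>T. maximal_subtree T \<and> fundamental_group T \<cong> H)"

text \<open>\<open>E\<^sub>0\<close> chooses one of the two orientations of every edge outside \<open>T\<close>.\<close>

definition outer_orientation :: "('v, 'e) pre_digraph \<Rightarrow> 'e set \<Rightarrow> bool" where
  "outer_orientation T E\<^sub>0 \<longleftrightarrow> E\<^sub>0 \<subseteq> arcs G - arcs T
     \<and> (\<forall>e\<in>arcs G - arcs T. (e \<in> E\<^sub>0) \<noteq> (arev e \<in> E\<^sub>0))"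

definition standard_generating_set :: "('g, 'm) monoid_scheme \<Rightarrow> 'g set \<Rightarrow> bool" where
  "standard_generating_set H X \<longleftrightarrow> (\<exists>T E\<^sub>0 \<phi>. maximal_subtree T \<and> outer_orientation T E\<^sub>0
     \<and> \<phi> \<in> iso (fundamental_group T) H
     \<and> X = \<phi> ` (vertex_gen T ` verts G \<union> stable_letter T ` E\<^sub>0))"

definition p_plateau :: "nat \<Rightarrow> ('v, 'e) pre_digraph \<Rightarrow> bool" where
  "p_plateau p P \<longleftrightarrow> serre_subgraph P \<and> verts P \<noteq> {} \<and> Digraph_Component.connected P
     \<and> (\<forall>e\<in>arcs G. tail G e \<in> verts P \<longrightarrow> (int p dvd lab e \<longleftrightarrow> e \<notin> arcs P))"

definition plateau :: "('v, 'e) pre_digraph \<Rightarrow> bool" where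
  "plateau P \<longleftrightarrow> (\<exists>p. prime p \<and> p_plateau p P)"

definition plateaunic_number :: nat where
  "plateaunic_number = (LEAST n. \<exists>X. X \<subseteq> verts G \<and> card X = n
     \<and> (\<forall>P. plateau P \<longrightarrow> X \<inter> verts P \<noteq> {}))"

text \<open>The relations of the standard presentation hold.\<close>

lemma vertex_gen_pow:
  assumes v: "v \<in> verts G"
  shows "vertex_gen T v [^]\<^bsub>fundamental_group T\<^esub> (n::int) = word_class T [Elt v n]"
proof -
  interpret F: group "fundamental_group T" by (rule group_fundamental_group)
  have hom: "(\<lambda>n. word_class T [Elt v n]) \<in> hom integer_group (fundamental_group T)"
    using v word_eq.sym[OF word_eq.elt_mult[of v _ _ T]]
    by (auto simp: hom_def carrier_fundamental_group gwords_def mult_word_class word_class_eq_iff)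
  interpret h: group_hom integer_group "fundamental_group T" "\<lambda>n. word_class T [Elt v n]"
    using hom by (simp add: group_hom_def group_hom_axioms_def F.is_group)
  have "word_class T [Elt v ((1::int) [^]\<^bsub>integer_group\<^esub> n)]
      = word_class T [Elt v 1] [^]\<^bsub>fundamental_group T\<^esub> n"
    by (rule h.hom_int_pow) simp
  then show ?thesis by (simp add: vertex_gen_def)
qed

lemma stable_letter_tree: "e \<in> arcs T \<Longrightarrow> stable_letter T e = \<one>\<^bsub>fundamental_group T\<^esub>"
  by (simp add: stable_letter_def one_fundamental_group word_class_eq_iff word_eq.tree_edge)

lemma standard_relation:
  assumes e: "e \<in> arcs G"
  shows "stable_letter T e \<otimes>\<^bsub>fundamental_group T\<^esub>
      (vertex_gen T (tail G e) [^]\<^bsub>fundamental_group T\<^esub> lab e) \<otimes>\<^bsub>fundamental_group T\<^esub>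
      (inv\<^bsub>fundamental_group T\<^esub> stable_letter T e)
    = vertex_gen T (tail G (arev e)) [^]\<^bsub>fundamental_group T\<^esub> lab (arev e)"
proof -
  interpret F: group "fundamental_group T" by (rule group_fundamental_group)
  have c: "word_class T [Edge e'] \<in> carrier (fundamental_group T)" if "e' \<in> arcs G" for e'
    using that by (auto simp: carrier_fundamental_group gwords_def)
  have "word_class T [Edge e] \<otimes>\<^bsub>fundamental_group T\<^esub> word_class T [Edge (arev e)]
      = \<one>\<^bsub>fundamental_group T\<^esub>"
    using word_eq.edge_inv[OF e, of T]
    by (simp add: mult_word_class one_fundamental_group word_class_eq_iff)
  then have "inv\<^bsub>fundamental_group T\<^esub> stable_letter T e = word_class T [Edge (arev e)]"
    unfolding stable_letter_def using c[OF e] c[of "arev e"] e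
    by (metis F.inv_equality F.inv_inv arev_in_arcs)
  then show ?thesis
    using e word_eq.edge_conj[OF e, of 1 T]
    by (simp add: vertex_gen_pow stable_letter_def mult_word_class word_class_eq_iff)
qed

end

end

theory Submission
  imports Defs "HOL-Library.Countable_Set"
begin

text \<open>
  Upper bound: let \<open>H\<close> be generated by the stable letters and the \<open>a\<^sub>v\<close> with \<open>v\<close> in a set \<open>X\<close> meeting
  every plateau, and let \<open>H\<close> meet \<open>\<langle>a\<^sub>v\<rangle>\<close> in \<open>\<langle>a\<^sub>v\<^sup>n\<rangle>\<close> with \<open>n = n(v)\<close>. If some \<open>n(v)\<close> is not 1, the vertices
  where a suitable prime \<open>p\<close> has maximal valuation in \<open>n\<close> contain a \<open>p\<close>-plateau, on which \<open>X\<close> has a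
  vertex with \<open>n = 1\<close>.

  Lower bound: \<open>k\<close> generators give a finite presentation of the one-point \<open>G\<close>-set by points, ties
  (powers of vertex generators) and edges (stable letters). Two edges that agree modulo the derivable
  relations are folded: one of them becomes a tie, which preserves the count of relations minus
  points. A presentation without such pairs embeds in a \<open>G\<close>-set, because partial equivariant
  matchings of \<open>\<int>\<close>-sets extend when there are infinitely many orbits of every type. As that \<open>G\<close>-set
  has to be trivial on the presentation, there is one tie component per vertex of the graph and at
  least one edge per edge of the graph, and the vertices whose ties are not a tree meet every
  plateau. Counting gives \<open>k \<ge> \<beta> + \<mu>\<close>.
\<close>

section \<open>Actions of the integers\<close>

text \<open>What is counted: a generator given by a word of length l contributes l + 1 positions, l
  letter relations and two relations that tie its ends to the base point. The base point is one more
  position, so k generators start with k - 1 more relations than positions. Spreading a position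
  over the vertices adds as many copies as tree edges and leaves this excess alone. At the end the
  ties over a vertex number at least its points minus one, with a surplus over a set meeting every
  plateau. The surplus comes from arithmetic modulo p. On a \<open>p\<close>-plateau the inner
  labels are invertible and the outward labels vanish modulo p, so edges impose nothing on exponents
  modulo p there; if the ties over it are trees, they impose nothing either, and
  \<open>a x = x\<close> cannot be derived. The obstacle is that a stable letter is at first a
  finite partial bijection. It extends to a permutation exactly when it matches two integer actions,
  stabilisers included. This is why derivability transports stabilisers along edges, why folding is
  tested against it, and how embeddings arise from permutations with no normal form theorem.\<close>

lemma int_subgroup_principal:
  fixes K :: "int set"
  assumes zero: "0 \<in> K" and diff: "\<And>i j. i \<in> K \<Longrightarrow> j \<in> K \<Longrightarrow> i - j \<in> K"
  shows "\<exists>n::nat. K = {k. int n dvd k}"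
proof (cases "K = {0}")
  case True
  then show ?thesis by (intro exI[of _ 0]) auto
next
  case False
  have neg: "- i \<in> K" if "i \<in> K" for i using diff[OF zero that] by simp
  have add: "i + j \<in> K" if "i \<in> K" "j \<in> K" for i j using diff[OF that(1) neg[OF that(2)]] by simp
  have nmult: "int m * i \<in> K" if "i \<in> K" for m i
    by (induction m) (auto simp: zero algebra_simps intro: add[OF that])
  have mult: "m * i \<in> K" if "i \<in> K" for m i
  proof (cases "m \<ge> 0")
    case True then show ?thesis using nmult[OF that, of "nat m"] by simp
  next
    case False then show ?thesis using neg[OF nmult[OF that, of "nat (- m)"]] by simp
  qed
  obtain i where i: "i \<in> K" "i \<noteq> 0" using False zero by blast
  then have "\<exists>n::nat. n > 0 \<and> int n \<in> K" using neg[OF i(1)]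
    by (intro exI[of _ "nat \<bar>i\<bar>"]) (cases "i \<ge> 0", auto)
  define n where "n = (LEAST n::nat. n > 0 \<and> int n \<in> K)"
  have n: "n > 0" "int n \<in> K"
    using LeastI_ex[OF \<open>\<exists>n::nat. n > 0 \<and> int n \<in> K\<close>] unfolding n_def by simp_all
  have least: "n \<le> m" if "m > 0" "int m \<in> K" for m
    unfolding n_def using that by (intro Least_le) simp
  have "int n dvd k" if "k \<in> K" for k
  proof (rule ccontr)
    assume "\<not> int n dvd k"
    then have "k mod int n \<noteq> 0" by (metis mod_0_imp_dvd)
    moreover have "k mod int n \<ge> 0" using n(1) by simp
    ultimately have pos: "k mod int n > 0" by simp
    have "k mod int n = k - (k div int n) * int n" by (simp add: minus_div_mult_eq_mod)
    then have "k mod int n \<in> K" using diff[OF that mult[OF n(2)]] by simp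
    then have "n \<le> nat (k mod int n)" using pos by (intro least) auto
    moreover have "k mod int n < int n" using n(1) by simp
    ultimately show False using pos by linarith
  qed
  moreover have "k \<in> K" if "int n dvd k" for k
    using that mult[OF n(2)] by (auto simp: dvd_def mult.commute)
  ultimately show ?thesis by blast
qed

section \<open>Orbits and stabilisers of integer actions, and extension of partial
  isomorphisms\<close>

definition zaction :: "(int \<Rightarrow> 'w \<Rightarrow> 'w) \<Rightarrow> bool" where
  "zaction a \<longleftrightarrow> (\<forall>x. a 0 x = x) \<and> (\<forall>i j x. a (i + j) x = a i (a j x))"

definition zorbit :: "(int \<Rightarrow> 'w \<Rightarrow> 'w) \<Rightarrow> 'w \<Rightarrow> 'w set" where
  "zorbit a x = range (\<lambda>k. a k x)"

definition zstab :: "(int \<Rightarrow> 'w \<Rightarrow> 'w) \<Rightarrow> 'w \<Rightarrow> int set" where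
  "zstab a x = {k. a k x = x}"

text \<open>The case \<open>n = 0\<close> collects the free orbits, a positive \<open>n\<close> the
  orbits with \<open>n\<close> points; every orbit has exactly one such type.\<close>

definition zorbits :: "(int \<Rightarrow> 'w \<Rightarrow> 'w) \<Rightarrow> 'w set \<Rightarrow> nat \<Rightarrow> 'w set set" where
  "zorbits a U n = zorbit a ` {x \<in> U. zstab a x = {k. int n dvd k}}"

definition zrich :: "(int \<Rightarrow> 'w \<Rightarrow> 'w) \<Rightarrow> 'w set \<Rightarrow> bool" where
  "zrich a U \<longleftrightarrow> (\<forall>n. infinite (zorbits a U n))"

lemma zaction_0 [simp]: "zaction a \<Longrightarrow> a 0 x = x"
  by (simp add: zaction_def)

lemma zaction_add: "zaction a \<Longrightarrow> a i (a j x) = a (i + j) x"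
  by (simp add: zaction_def)

lemma zaction_move:
  assumes "zaction a"
  shows "a i x = y \<longleftrightarrow> x = a (- i) y"
  using assms by (auto simp: zaction_add)

lemma zaction_eq_iff:
  assumes "zaction a"
  shows "a i x = a j x \<longleftrightarrow> i - j \<in> zstab a x"
proof -
  have "a (i - j) x = a (- j) (a i x)" using assms by (simp add: zaction_add)
  then show ?thesis using zaction_move[OF assms, of "- j" "a i x" x] by (simp add: zstab_def)
qed

lemma zstab_move:
  assumes "zaction a"
  shows "zstab a (a i x) = zstab a x"
proof -
  have "a k (a i x) = a i (a k x)" for k using assms by (simp add: zaction_add add.commute)
  moreover have "a i y = a i x \<longleftrightarrow> y = x" for y
    using zaction_move[OF assms, of i y "a i x"] assms by (simp add: zaction_add)
  ultimately show ?thesis by (simp add: zstab_def)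
qed

lemma zorbit_move:
  assumes "zaction a"
  shows "zorbit a (a i x) = zorbit a x"
proof -
  have "zorbit a (a i x) = (\<lambda>k. a k x) ` range (\<lambda>k. k + i)"
    unfolding zorbit_def image_image using assms by (simp add: zaction_add)
  also have "range (\<lambda>k. k + i) = UNIV" by (rule surjI[of _ "\<lambda>k. k - i"]) simp
  finally show ?thesis by (simp add: zorbit_def)
qed

lemma zorbit_self: "zaction a \<Longrightarrow> x \<in> zorbit a x"
  unfolding zorbit_def by (metis rangeI zaction_0)

lemma zstab_principal:
  assumes "zaction a"
  shows "\<exists>n::nat. zstab a x = {k. int n dvd k}"
proof (rule int_subgroup_principal)
  fix i j assume "i \<in> zstab a x" "j \<in> zstab a x"
  then have "a i x = a j x" by (simp add: zstab_def)
  then show "i - j \<in> zstab a x" using assms by (simp add: zaction_eq_iff)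
qed (use assms in \<open>simp add: zstab_def\<close>)

lemma int_dvd_sets_eq:
  assumes "{k. int n dvd k} = {k. int m dvd k}"
  shows "n = m"
proof -
  have "int m \<in> {k. int n dvd k}" "int n \<in> {k. int m dvd k}" by (simp add: assms, simp add: assms[symmetric])
  then show ?thesis by (simp add: dvd_antisym)
qed

text \<open>An integer action is determined by the number of orbits of each type. Richness and
  countability make all these numbers countably infinite, so orbits can be matched type by type;
  \<open>r\<close> and \<open>s\<close> choose base points in them.\<close>

lemma zrich_equivariant_bij:
  fixes a :: "int \<Rightarrow> 'u::countable \<Rightarrow> 'u" and b :: "int \<Rightarrow> 'w::countable \<Rightarrow> 'w"
  assumes a: "zaction a" and b: "zaction b"
    and U: "\<And>x k. x \<in> U \<Longrightarrow> a k x \<in> U" and W: "\<And>x k. x \<in> W \<Longrightarrow> b k x \<in> W"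
    and rich: "zrich a U" "zrich b W"
  shows "\<exists>\<phi>. bij_betw \<phi> U W \<and> (\<forall>x\<in>U. \<forall>k. \<phi> (a k x) = b k (\<phi> x))"
proof -
  have "\<exists>\<beta>. bij_betw \<beta> (zorbits a U n) (zorbits b W n)" for n
  proof -
    have "countable (zorbits a U n)" "countable (zorbits b W n)"
      unfolding zorbits_def by (rule countable_image, rule countableI_type)+
    moreover have "infinite (zorbits a U n)" "infinite (zorbits b W n)"
      using rich unfolding zrich_def by blast+
    ultimately show ?thesis by (meson bij_betw_from_nat_into bij_betw_inv bij_betw_trans)
  qed
  then obtain \<beta> where \<beta>: "\<And>n. bij_betw (\<beta> n) (zorbits a U n) (zorbits b W n)" by metis
  define n where "n x = (SOME n. zstab a x = {k. int n dvd k})" for x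
  have n: "zstab a x = {k. int (n x) dvd k}" for x
    using someI_ex[OF zstab_principal[OF a]] unfolding n_def .
  have n_eqI: "n x = m" if "zstab a x = {k. int m dvd k}" for x m
    using n[of x] that int_dvd_sets_eq by metis
  define r where "r O' = (SOME x. x \<in> O')" for O' :: "'u set"
  define s where "s O' = (SOME x. x \<in> O')" for O' :: "'w set"
  have r: "\<exists>k. r (zorbit a x) = a k x" for x
    using someI[of "\<lambda>y. y \<in> zorbit a x", OF zorbit_self[OF a]] unfolding r_def zorbit_def by auto
  have s: "\<exists>k. s (zorbit b x) = b k x" for x
    using someI[of "\<lambda>y. y \<in> zorbit b x", OF zorbit_self[OF b]] unfolding s_def zorbit_def by auto
  have r': "\<exists>k. a k (r (zorbit a x)) = x" for x
    using r[of x] zaction_move[OF a] by metis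
  have s': "\<exists>k. b k (s (zorbit b x)) = x" for x
    using s[of x] zaction_move[OF b] by metis
  have stab_r: "zstab a (r (zorbit a x)) = zstab a x" for x
    using r[of x] zstab_move[OF a] by metis
  define \<psi> where "\<psi> x = s (\<beta> (n x) (zorbit a x))" for x
  have orb_U: "zorbit a x \<in> zorbits a U (n x)" if "x \<in> U" for x
    using that n[of x] unfolding zorbits_def by blast
  have \<psi>: "\<psi> x \<in> W \<and> zstab b (\<psi> x) = {k. int (n x) dvd k} \<and> zorbit b (\<psi> x) = \<beta> (n x) (zorbit a x)"
    if "x \<in> U" for x
  proof -
    have "\<beta> (n x) (zorbit a x) \<in> zorbits b W (n x)"
      using \<beta>[of "n x"] orb_U[OF that] by (meson bij_betwE)
    then obtain w where w: "w \<in> W" "zstab b w = {k. int (n x) dvd k}" "\<beta> (n x) (zorbit a x) = zorbit b w"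
      unfolding zorbits_def by blast
    obtain k where "\<psi> x = b k w" using s[of w] w(3) unfolding \<psi>_def by auto
    then show ?thesis using w W zstab_move[OF b] zorbit_move[OF b] by simp
  qed
  \<comment> \<open>Send \<open>a k\<close> of the base point to \<open>b k\<close> of the matched
    base point. The exponent is unique only up to the stabiliser, which is the same on both sides,
    so the choice does not affect the value.\<close>
  define \<phi> where "\<phi> x = b (SOME k. a k (r (zorbit a x)) = x) (\<psi> x)" for x
  have \<phi>: "\<phi> x = b k (\<psi> x)" if "x \<in> U" "a k (r (zorbit a x)) = x" for x k
  proof -
    let ?k = "SOME k. a k (r (zorbit a x)) = x"
    have "a ?k (r (zorbit a x)) = a k (r (zorbit a x))"
      using someI_ex[OF r'[of x]] that(2) by simp
    then have "?k - k \<in> zstab a (r (zorbit a x))" using zaction_eq_iff[OF a] by blast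
    then have "?k - k \<in> zstab b (\<psi> x)" using stab_r n \<psi>[OF that(1)] by metis
    then show ?thesis unfolding \<phi>_def using zaction_eq_iff[OF b] by blast
  qed
  have n_move: "n (a j x) = n x" for j x
    using n[of x] n_eqI zstab_move[OF a] by metis
  have \<psi>_move: "\<psi> (a j x) = \<psi> x" for j x
    by (simp add: \<psi>_def zorbit_move[OF a] n_move)
  have equiv: "\<phi> (a j x) = b j (\<phi> x)" if "x \<in> U" for j x
  proof -
    obtain k where k: "a k (r (zorbit a x)) = x" using r' by blast
    then have "a (j + k) (r (zorbit a (a j x))) = a j x"
      by (metis a zaction_add zorbit_move)
    then have "\<phi> (a j x) = b (j + k) (\<psi> x)" using \<phi>[OF U[OF that]] \<psi>_move by metis
    then show ?thesis using \<phi>[OF that k] zaction_add[OF b] by simp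
  qed
  have stab_\<phi>: "zstab b (\<phi> x) = {k. int (n x) dvd k}" and orb_\<phi>: "zorbit b (\<phi> x) = \<beta> (n x) (zorbit a x)"
    if "x \<in> U" for x
    using \<psi>[OF that] zstab_move[OF b] zorbit_move[OF b] unfolding \<phi>_def by auto
  have "inj_on \<phi> U"
  proof (rule inj_onI)
    fix x y assume xy: "x \<in> U" "y \<in> U" "\<phi> x = \<phi> y"
    have nxy: "n x = n y" using stab_\<phi>[OF xy(1)] stab_\<phi>[OF xy(2)] xy(3) int_dvd_sets_eq by metis
    have "\<beta> (n x) (zorbit a x) = \<beta> (n x) (zorbit a y)"
      using orb_\<phi>[OF xy(1)] orb_\<phi>[OF xy(2)] xy(3) nxy by metis
    then have O: "zorbit a x = zorbit a y"
      using \<beta>[of "n x"] orb_U[OF xy(1)] orb_U[OF xy(2)] nxy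
      by (metis bij_betw_imp_inj_on inj_onD)
    have "y \<in> zorbit a x" using zorbit_self[OF a, of y] O by simp
    then obtain k where k: "a k x = y" unfolding zorbit_def by auto
    then have "b k (\<phi> x) = \<phi> x" using equiv[OF xy(1)] xy(3) by metis
    then have "k \<in> zstab a x" using stab_\<phi>[OF xy(1)] n[of x] by (simp only: zstab_def) blast
    then show "x = y" using k by (simp add: zstab_def)
  qed
  moreover have "\<phi> ` U = W"
  proof
    show "\<phi> ` U \<subseteq> W" using \<psi> W unfolding \<phi>_def by blast
    show "W \<subseteq> \<phi> ` U"
    proof
      fix w assume w: "w \<in> W"
      obtain m where m: "zstab b w = {k. int m dvd k}" using zstab_principal[OF b] by blast
      then have "zorbit b w \<in> zorbits b W m" using w unfolding zorbits_def by blast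
      then obtain O' where O': "O' \<in> zorbits a U m" "\<beta> m O' = zorbit b w"
        using \<beta>[of m] by (metis bij_betw_imp_surj_on imageE)
      then obtain x where x: "x \<in> U" "zstab a x = {k. int m dvd k}" "O' = zorbit a x"
        unfolding zorbits_def by blast
      have "zorbit b (\<phi> x) = zorbit b w" using orb_\<phi>[OF x(1)] n_eqI[OF x(2)] O' x(3) by simp
      then have "w \<in> zorbit b (\<phi> x)" using zorbit_self[OF b, of w] by simp
      then obtain k where "b k (\<phi> x) = w" unfolding zorbit_def by auto
      then have "\<phi> (a k x) = w" using equiv[OF x(1)] by simp
      then show "w \<in> \<phi> ` U" using U[OF x(1)] by blast
    qed
  qed
  ultimately show ?thesis using equiv unfolding bij_betw_def by blast
qed

lemma zaction_scale: "zaction a \<Longrightarrow> zaction (\<lambda>k. a (l * k))"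
  by (simp add: zaction_def distrib_left)

text \<open>Restricting to the subgroup generated by \<open>l\<close> splits an orbit with
  stabiliser generated by \<open>n * |l|\<close> into orbits with stabiliser generated by
  \<open>n\<close>. Sending a small orbit to the large one around it therefore reaches infinitely
  many orbits.\<close>

lemma zrich_scale:
  assumes a: "zaction a" and rich: "zrich a UNIV" and l: "l \<noteq> 0"
  shows "zrich (\<lambda>k. a (l * k)) UNIV"
  unfolding zrich_def
proof
  fix n
  let ?b = "\<lambda>k. a (l * k)"
  let ?m = "n * nat \<bar>l\<bar>"
  have "zorbits a UNIV ?m \<subseteq> (\<lambda>O'. \<Union>x\<in>O'. zorbit a x) ` zorbits ?b UNIV n"
  proof
    fix O' assume "O' \<in> zorbits a UNIV ?m"
    then obtain x where x: "zstab a x = {k. int ?m dvd k}" "O' = zorbit a x"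
      unfolding zorbits_def by blast
    have "int ?m dvd l * k \<longleftrightarrow> int n dvd k" for k
    proof -
      have "int ?m = \<bar>l * int n\<bar>" by (simp add: abs_mult mult.commute)
      then have "int ?m dvd l * k \<longleftrightarrow> l * int n dvd l * k" by (simp only: abs_dvd_iff)
      then show ?thesis using l by simp
    qed
    then have "zstab ?b x = {k. int n dvd k}"
      using x(1) unfolding zstab_def by auto
    then have "zorbit ?b x \<in> zorbits ?b UNIV n" unfolding zorbits_def by blast
    moreover have "(\<Union>y\<in>zorbit ?b x. zorbit a y) = O'"
      using x(2) zorbit_move[OF a] unfolding zorbit_def[of ?b] by auto
    ultimately show "O' \<in> (\<lambda>O'. \<Union>x\<in>O'. zorbit a x) ` zorbits ?b UNIV n" by blast
  qed
  moreover have "infinite (zorbits a UNIV ?m)" using rich unfolding zrich_def by blast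
  ultimately show "infinite (zorbits ?b UNIV n)" by (meson finite_imageI finite_subset)
qed

text \<open>The condition \<open>match\<close> makes \<open>M\<close> span an isomorphism between
  two unions of finitely many orbits. Removing finitely many orbits keeps richness, so the
  complements are isomorphic as well, and the two isomorphisms are glued.\<close>

lemma zrich_extend:
  fixes a b :: "int \<Rightarrow> 'w::countable \<Rightarrow> 'w" and M :: "('w \<times> 'w) set"
  assumes a: "zaction a" and b: "zaction b" and rich: "zrich a UNIV" "zrich b UNIV"
    and fin: "finite M"
    and match: "\<And>x y x' y' k. (x, y) \<in> M \<Longrightarrow> (x', y') \<in> M \<Longrightarrow> a k x = x' \<longleftrightarrow> b k y = y'"
  shows "\<exists>\<phi>. bij \<phi> \<and> (\<forall>x k. \<phi> (a k x) = b k (\<phi> x)) \<and> (\<forall>(x, y)\<in>M. \<phi> x = y)"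
proof -
  define U where "U = - (\<Union>x\<in>fst ` M. zorbit a x)"
  define W where "W = - (\<Union>x\<in>snd ` M. zorbit b x)"
  have inv: "c k x \<in> - (\<Union>x\<in>F. zorbit c x)" if "zaction c" "x \<in> - (\<Union>x\<in>F. zorbit c x)"
    for c :: "int \<Rightarrow> 'w \<Rightarrow> 'w" and k x F
  proof -
    have "x \<in> zorbit c z" if z: "c k x \<in> zorbit c z" for z
    proof -
      obtain j where "c k x = c j z" using z unfolding zorbit_def by blast
      then have "x = c (- k + j) z" using zaction_move[OF \<open>zaction c\<close>] zaction_add[OF \<open>zaction c\<close>] by metis
      then show ?thesis unfolding zorbit_def by blast
    qed
    then show ?thesis using that(2) by blast
  qed
  have rest: "zrich c (- (\<Union>x\<in>F. zorbit c x))" if c: "zaction c" "zrich c UNIV" "finite F"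
    for c :: "int \<Rightarrow> 'w \<Rightarrow> 'w" and F
    unfolding zrich_def
  proof
    fix n
    have "zorbits c UNIV n \<subseteq> zorbits c (- (\<Union>x\<in>F. zorbit c x)) n \<union> zorbit c ` F"
    proof
      fix O' assume "O' \<in> zorbits c UNIV n"
      then obtain x where x: "zstab c x = {k. int n dvd k}" "O' = zorbit c x"
        unfolding zorbits_def by blast
      show "O' \<in> zorbits c (- (\<Union>x\<in>F. zorbit c x)) n \<union> zorbit c ` F"
      proof (cases "\<exists>z\<in>F. x \<in> zorbit c z")
        case True
        then obtain z k where "z \<in> F" "x = c k z" unfolding zorbit_def by blast
        then show ?thesis using x(2) zorbit_move[OF c(1)] by auto
      next
        case False
        then show ?thesis using x unfolding zorbits_def by blast
      qed
    qed
    moreover have "infinite (zorbits c UNIV n)" using c(2) unfolding zrich_def by blast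
    ultimately show "infinite (zorbits c (- (\<Union>x\<in>F. zorbit c x)) n)"
      using c(3) by (meson finite_UnI finite_imageI finite_subset)
  qed
  have "\<exists>\<chi>. bij_betw \<chi> U W \<and> (\<forall>x\<in>U. \<forall>k. \<chi> (a k x) = b k (\<chi> x))"
    unfolding U_def W_def
    by (rule zrich_equivariant_bij[OF a b inv[OF a] inv[OF b] rest[OF a rich(1)] rest[OF b rich(2)]])
      (use fin in auto)
  then obtain \<chi> where \<chi>: "bij_betw \<chi> U W" "\<And>x k. x \<in> U \<Longrightarrow> \<chi> (a k x) = b k (\<chi> x)"
    by blast
  have ex: "\<exists>y. \<exists>(x', y')\<in>M. \<exists>k. x = a k x' \<and> y = b k y'" if "x \<notin> U" for x
    using that unfolding U_def zorbit_def by force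
  have ex': "\<exists>x. \<exists>(x', y')\<in>M. \<exists>k. x = a k x' \<and> y = b k y'" if "y \<notin> W" for y
    using that unfolding W_def zorbit_def by force
  define \<omega> where "\<omega> x = (SOME y. \<exists>(x', y')\<in>M. \<exists>k. x = a k x' \<and> y = b k y')" for x
  \<comment> \<open>Translating one exponent to the other side reduces two exponents to the single
    one of \<open>match\<close>; this is well-definedness and injectivity of the map on the orbits
    of \<open>M\<close>.\<close>
  have mm: "a k x = a k' x' \<longleftrightarrow> b k y = b k' y'" if "(x, y) \<in> M" "(x', y') \<in> M" for x y x' y' k k'
  proof -
    have "a k x = a k' x' \<longleftrightarrow> a (k - k') x = x'"
      using zaction_move[OF a, of "- k'" "a k x" x'] zaction_add[OF a, of "- k'" k x] by (simp add: algebra_simps)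
    moreover have "b k y = b k' y' \<longleftrightarrow> b (k - k') y = y'"
      using zaction_move[OF b, of "- k'" "b k y" y'] zaction_add[OF b, of "- k'" k y] by (simp add: algebra_simps)
    ultimately show ?thesis using match[OF that] by simp
  qed
  have \<omega>: "\<omega> (a k x) = b k y" if "(x, y) \<in> M" for x y k
    unfolding \<omega>_def
  proof (rule some_equality)
    show "\<exists>(x', y')\<in>M. \<exists>k'. a k x = a k' x' \<and> b k y = b k' y'" using that by blast
    fix z assume "\<exists>(x', y')\<in>M. \<exists>k'. a k x = a k' x' \<and> z = b k' y'"
    then show "z = b k y" using mm[OF that] by auto
  qed
  have notU: "a k x \<notin> U" "b k y \<notin> W" if "(x, y) \<in> M" for x y k
    using that unfolding U_def W_def zorbit_def by force+
  define \<phi> where "\<phi> x = (if x \<in> U then \<chi> x else \<omega> x)" for x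
  have notU_cases: "\<exists>x' y' k. (x', y') \<in> M \<and> x = a k x'" if "x \<notin> U" for x
    using ex[OF that] by blast
  have notU': "a k x \<notin> U \<longleftrightarrow> x \<notin> U" for k x
    using inv[OF a, of x "fst ` M"] inv[OF a, of "a k x" "fst ` M" "- k"] zaction_add[OF a, of "- k" k x] a
    unfolding U_def by auto
  have "bij_betw \<omega> (- U) (- W)"
    unfolding bij_betw_def
  proof
    show "inj_on \<omega> (- U)"
    proof (rule inj_onI)
      fix x x' assume "x \<in> - U" "x' \<in> - U" "\<omega> x = \<omega> x'"
      then show "x = x'" using notU_cases[of x] notU_cases[of x'] \<omega> mm by (metis ComplD)
    qed
    show "\<omega> ` (- U) = - W"
    proof
      show "\<omega> ` (- U) \<subseteq> - W" using notU_cases \<omega> notU(2) by fastforce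
      show "- W \<subseteq> \<omega> ` (- U)"
      proof
        fix y assume "y \<in> - W"
        then obtain x' y' k where "(x', y') \<in> M" "y = b k y'" using ex'[of y] by auto
        then show "y \<in> \<omega> ` (- U)" using \<omega> notU(1) by (metis ComplI imageI)
      qed
    qed
  qed
  then have "bij_betw \<phi> (- U) (- W)" by (subst bij_betw_cong[of _ _ \<omega>]) (auto simp: \<phi>_def)
  moreover have "bij_betw \<phi> U W" using \<chi>(1) by (subst bij_betw_cong[of _ _ \<chi>]) (auto simp: \<phi>_def)
  ultimately have "bij_betw \<phi> (U \<union> - U) (W \<union> - W)" by (intro bij_betw_combine) auto
  then have "bij \<phi>" by simp
  moreover have "\<phi> (a k x) = b k (\<phi> x)" for k x
  proof (cases "x \<in> U")
    case True
    then show ?thesis using \<chi>(2) notU'[of k x] by (simp add: \<phi>_def)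
  next
    case False
    then obtain x' y' j where xy: "(x', y') \<in> M" "x = a j x'" using notU_cases by blast
    have "\<phi> (a k x) = \<omega> (a (k + j) x')" using False notU'[of k x] xy zaction_add[OF a] by (simp add: \<phi>_def)
    also have "\<dots> = b k (\<omega> (a j x'))" using \<omega>[OF xy(1)] zaction_add[OF b] by simp
    finally show ?thesis using xy False by (simp add: \<phi>_def)
  qed
  moreover have "\<phi> x = y" if "(x, y) \<in> M" for x y
    using \<omega>[OF that, of 0] notU(1)[OF that, of 0] a b by (simp add: \<phi>_def)
  ultimately show ?thesis by blast
qed

text \<open>Read \<open>D x k y\<close> as the relation that moving \<open>x\<close> by
  \<open>k\<close> gives \<open>y\<close>. The hypotheses say that the relations are closed under
  consequences, so the quotient of \<open>P\<close> times the integers by them satisfies no others.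
  Infinitely many orbits of every type are added as a disjoint summand.\<close>

lemma zset_realization:
  fixes D :: "'p \<Rightarrow> int \<Rightarrow> 'p \<Rightarrow> bool"
  assumes fin: "finite P" and D_refl: "\<And>x. D x 0 x" and D_sym: "\<And>x k y. D x k y \<Longrightarrow> D y (- k) x"
    and D_trans: "\<And>x k y l z. D x k y \<Longrightarrow> D y l z \<Longrightarrow> D x (k + l) z"
  shows "\<exists>(a :: int \<Rightarrow> nat \<Rightarrow> nat) f. zaction a \<and> zrich a UNIV
    \<and> (\<forall>x\<in>P. \<forall>y\<in>P. \<forall>k. a k (f x) = f y \<longleftrightarrow> D x k y)"
proof -
  \<comment> \<open>\<open>cls x i\<close> is the class of the formal point obtained from
    \<open>x\<close> by moving \<open>i\<close> steps.\<close>
  define cls where "cls x i = {(y, j). D x (i - j) y}" for x i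
  define shift where "shift k C = {(y, j). (y, j - k) \<in> C}" for k :: int and C :: "('p \<times> int) set"
  \<comment> \<open>\<open>Inr (j, n, i)\<close> is the residue \<open>i\<close> in the
    \<open>j\<close>-th copy of the integers modulo \<open>n\<close>; for \<open>n = 0\<close> this
    is the integers, since \<open>i mod 0 = i\<close>. Triples with a non-canonical residue are
    fixed, which keeps \<open>b\<close> an action on the whole type.\<close>
  define b :: "int \<Rightarrow> ('p \<times> int) set + nat \<times> nat \<times> int \<Rightarrow> ('p \<times> int) set + nat \<times> nat \<times> int"
    where "b k w = (case w of Inl C \<Rightarrow> Inl (shift k C)
      | Inr (j, n, i) \<Rightarrow> if i mod int n = i then Inr (j, n, (i + k) mod int n) else w)" for k w
  have b: "zaction b"
    unfolding zaction_def b_def shift_def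
    by (auto simp: algebra_simps mod_simps split: sum.splits)
  \<comment> \<open>Only classes of points of the finite set \<open>P\<close> are kept: the type of
    all sets of pairs may be uncountable, and the action has to be moved to the natural
    numbers.\<close>
  define \<Omega> :: "(('p \<times> int) set + nat \<times> nat \<times> int) set" where "\<Omega> = Inl ` (\<lambda>(x, i). cls x i) ` (P \<times> UNIV) \<union> range Inr"
  have shift_cls: "shift k (cls x i) = cls x (i + k)" for k x i
    by (simp add: shift_def cls_def algebra_simps)
  have cls_eq: "cls x i = cls y j \<longleftrightarrow> D x (i - j) y" for x i y j
  proof
    assume "cls x i = cls y j"
    moreover have "(y, j) \<in> cls y j" using D_refl by (simp add: cls_def)
    ultimately have "(y, j) \<in> cls x i" by simp
    then show "D x (i - j) y" by (simp add: cls_def)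
  next
    assume xy: "D x (i - j) y"
    have "D x (i - l) z \<longleftrightarrow> D y (j - l) z" for z l
      using D_trans[OF xy, of "j - l" z] D_trans[OF D_sym[OF xy], of "i - l" z] by auto
    then show "cls x i = cls y j" by (simp add: cls_def)
  qed
  have Inl_\<Omega>: "Inl (cls x i) \<in> \<Omega>" if "x \<in> P" for x i using that unfolding \<Omega>_def by force
  have \<Omega>: "b k w \<in> \<Omega>" if w: "w \<in> \<Omega>" for k w
  proof (cases w)
    case (Inl C)
    then obtain x i where "x \<in> P" "C = cls x i" using w unfolding \<Omega>_def by fastforce
    then show ?thesis using Inl Inl_\<Omega> by (simp add: b_def shift_cls)
  next
    case (Inr t)
    then have "b k w \<in> range Inr" by (cases t) (simp add: b_def)
    then show ?thesis unfolding \<Omega>_def by blast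
  qed
  have count: "countable \<Omega>"
    unfolding \<Omega>_def using fin
    by (intro countable_Un countable_image countable_SIGMA countable_finite countableI_type)
  have "infinite (range (\<lambda>j::nat. (Inr (j, 0, 0) :: ('p \<times> int) set + nat \<times> nat \<times> int)))"
    by (intro range_inj_infinite injI) simp
  moreover have "range (\<lambda>j::nat. Inr (j, 0, 0)) \<subseteq> \<Omega>" unfolding \<Omega>_def by blast
  ultimately have "infinite \<Omega>" by (meson finite_subset)
  with count obtain h :: "_ \<Rightarrow> nat" where h: "bij_betw h \<Omega> UNIV" using countableE_infinite by blast
  define g where "g = inv_into \<Omega> h"
  have g: "g m \<in> \<Omega>" "h (g m) = m" for m
    unfolding g_def using h by (auto intro: inv_into_into f_inv_into_f simp: bij_betw_def)
  have gh: "g (h w) = w" if "w \<in> \<Omega>" for w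
    unfolding g_def using h that by (simp add: bij_betw_def)
  define a where "a k m = h (b k (g m))" for k m
  have a: "zaction a"
    unfolding zaction_def a_def using g \<Omega> gh b by (simp add: zaction_add)
  have ah: "a k (h w) = h (b k w)" if "w \<in> \<Omega>" for k w
    using that by (simp add: a_def gh)
  have h_eq: "h w = h w' \<longleftrightarrow> w = w'" if "w \<in> \<Omega>" "w' \<in> \<Omega>" for w w'
    using that gh by metis
  define f where "f x = h (Inl (cls x 0))" for x
  have "a k (f x) = f y \<longleftrightarrow> D x k y" if "x \<in> P" "y \<in> P" for x y k
  proof -
    have "a k (f x) = f y \<longleftrightarrow> cls x k = cls y 0"
      using Inl_\<Omega> that by (simp add: f_def ah h_eq b_def shift_cls)
    then show ?thesis by (simp add: cls_eq)
  qed
  moreover have "zrich a UNIV"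
    unfolding zrich_def
  proof
    fix n
    define w where "w j = (Inr (j, n, 0) :: ('p \<times> int) set + nat \<times> nat \<times> int)" for j
    have w: "w j \<in> \<Omega>" for j unfolding w_def \<Omega>_def by blast
    have bw: "b k (w j) = Inr (j, n, k mod int n)" for k j by (simp add: b_def w_def)
    have "zstab a (h (w j)) = {k. int n dvd k}" for j
      unfolding zstab_def using w \<Omega>[OF w]
      by (simp add: ah h_eq bw[unfolded w_def] w_def dvd_eq_mod_eq_0 del: mod_eq_0_iff_dvd)
    then have "range (\<lambda>j. zorbit a (h (w j))) \<subseteq> zorbits a UNIV n"
      unfolding zorbits_def by blast
    moreover have "inj (\<lambda>j. zorbit a (h (w j)))"
    proof (rule injI)
      fix j j' assume "zorbit a (h (w j)) = zorbit a (h (w j'))"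
      then have "h (w j') \<in> zorbit a (h (w j))" using zorbit_self[OF a] by simp
      then obtain k where "h (w j') = a k (h (w j))" unfolding zorbit_def by blast
      then have "w j' = b k (w j)" using w \<Omega>[OF w] by (simp add: ah h_eq)
      then show "j = j'" unfolding bw by (simp add: w_def)
    qed
    ultimately show "infinite (zorbits a UNIV n)"
      by (meson finite_subset range_inj_infinite)
  qed
  ultimately show ?thesis using a by blast
qed

section \<open>Presentations and folding\<close>

text \<open>The last clause is the forest case: exponents on the edges of a forest are differences
  of a potential \<open>pos\<close>. A new tie either stays inside a component, which makes the
  count strict, or merges two components, and then the potential on one of them is shifted as a
  whole.\<close>

lemma tie_components:
  fixes A :: "('p \<times> int \<times> 'p) set"
  assumes "finite A" "finite P" "\<And>x k y. (x, k, y) \<in> A \<Longrightarrow> x \<in> P \<and> y \<in> P"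
  shows "\<exists>comp :: 'p \<Rightarrow> 'p. (\<forall>(x, k, y)\<in>A. comp x = comp y) \<and> card P \<le> card (comp ` P) + card A
    \<and> (card P = card (comp ` P) + card A \<longrightarrow> (\<exists>pos. \<forall>(x, k, y)\<in>A. pos y = pos x + k))"
  using assms(1,3)
proof (induction A rule: finite_induct)
  case empty
  show ?case by (rule exI[of _ id]) simp
next
  case (insert t A)
  obtain x k y where t: "t = (x, k, y)" by (cases t)
  obtain comp :: "'p \<Rightarrow> 'p" where comp: "\<forall>(x, k, y)\<in>A. comp x = comp y" "card P \<le> card (comp ` P) + card A"
    "card P = card (comp ` P) + card A \<Longrightarrow> \<exists>pos. \<forall>(x, k, y)\<in>A. pos y = pos x + k"
    using insert.IH insert.prems by (metis (no_types, lifting) insertCI)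
  have xy: "x \<in> P" "y \<in> P" using insert.prems t by blast+
  show ?case
  proof (cases "comp x = comp y")
    case True
    then show ?thesis using comp insert.hyps t by (intro exI[of _ comp]) auto
  next
    case False
    define comp' where "comp' z = (if comp z = comp y then comp x else comp z)" for z
    have "comp' ` P = comp ` P - {comp y}"
      using xy False unfolding comp'_def by (auto simp: image_iff)
    then have card: "card (comp ` P) = Suc (card (comp' ` P))"
      using xy assms(2) by (metis card_Suc_Diff1 finite_imageI imageI)
    have "\<exists>pos. \<forall>(x, k, y)\<in>insert t A. pos y = pos x + k"
      if "card P = card (comp' ` P) + card (insert t A)"
    proof -
      have "card P = card (comp ` P) + card A" using that card insert.hyps by simp
      then obtain pos where pos: "\<forall>(x, k, y)\<in>A. pos y = pos x + k"
        using comp(3) by blast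
      \<comment> \<open>The class of \<open>y\<close> is moved by the constant that makes the new
        tie hold; the old ties join points of equal class, so they are preserved.\<close>
      define pos' where "pos' z = (if comp z = comp y then pos z + (pos x + k - pos y) else pos z)" for z
      have "pos' y' = pos' x' + k'" if "(x', k', y') \<in> A" for x' k' y'
        using that pos comp(1) unfolding pos'_def by fastforce
      moreover have "pos' y = pos' x + k" using False by (simp add: pos'_def)
      ultimately show ?thesis using t by blast
    qed
    moreover have "\<forall>(x, k, y)\<in>insert t A. comp' x = comp' y"
      using comp(1) t unfolding comp'_def by auto
    ultimately show ?thesis using comp(2) card insert.hyps
      by (intro exI[of _ comp'] conjI) auto
  qed
qed

text \<open>
  A triple \<open>(x, k, y)\<close> in \<open>A\<close> stands for the relation \<open>a\<^sup>k x = y\<close> and a triple \<open>(x, e, y)\<close> in \<open>B\<close> for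
  \<open>t\<^sub>e x = y\<close>. Derivability only lets an edge transport stabilisers, so it never joins points that no
  chain of ties joins; otherwise deleting an edge in a fold could destroy the derivation that
  justified the fold.
\<close>

inductive derivable :: "('e \<Rightarrow> 'e) \<Rightarrow> ('e \<Rightarrow> int) \<Rightarrow> ('p \<times> int \<times> 'p) set \<Rightarrow> ('p \<times> 'e \<times> 'p) set
    \<Rightarrow> 'p \<Rightarrow> int \<Rightarrow> 'p \<Rightarrow> bool"
  for arev lab A B where
  refl: "derivable arev lab A B x 0 x"
| tie: "(x, k, y) \<in> A \<Longrightarrow> derivable arev lab A B x k y"
| sym: "derivable arev lab A B x k y \<Longrightarrow> derivable arev lab A B y (- k) x"
| trans: "derivable arev lab A B x k y \<Longrightarrow> derivable arev lab A B y l z \<Longrightarrow> derivable arev lab A B x (k + l) z"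
| edge: "(x, e, y) \<in> B \<Longrightarrow> derivable arev lab A B x (lab e * k) x \<Longrightarrow>
    derivable arev lab A B y (lab (arev e) * k) y"

text \<open>The exponent \<open>c\<close> may differ from \<open>k\<close>: the edge rule only
  concludes loops, so it affects which exponents occur but not which points are joined.\<close>

lemma derivable_tie_connected:
  "derivable arev lab A B x k y \<Longrightarrow> \<exists>c. derivable arev lab A {} x c y"
  by (induction rule: derivable.induct) (blast intro: derivable.intros)+

lemma derivable_mono:
  assumes "derivable arev lab A B x k y" "A \<subseteq> A'" "B \<subseteq> B'"
  shows "derivable arev lab A' B' x k y"
  using assms(1) by (induction rule: derivable.induct) (use assms(2,3) in \<open>blast intro: derivable.intros\<close>)+

text \<open>The integers are abelian, so all points of an orbit have the same stabiliser.\<close>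

lemma derivable_conj:
  assumes "derivable arev lab A B x c y" "derivable arev lab A B x k x"
  shows "derivable arev lab A B y k y"
  using derivable.trans[OF derivable.trans[OF derivable.sym[OF assms(1)] assms(2)] assms(1)] by simp

text \<open>Nothing is lost when the edge from \<open>x'\<close> to \<open>y'\<close> is exchanged
  for the tie from \<open>y\<close> to \<open>y'\<close>. A stabiliser that the deleted edge carried
  can be moved from \<open>x'\<close> to \<open>x\<close>, through the remaining edge to
  \<open>y\<close>, and along the new tie to \<open>y'\<close>.\<close>

lemma derivable_fold:
  assumes der: "derivable arev lab A B x (lab e * k) x'"
    and B': "(x, e, y) \<in> B'" "(y, arev e, x) \<in> B'"
    and B: "B \<subseteq> B' \<union> {(x', e, y'), (y', arev e, x')}"
    and invol: "arev (arev e) = e"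
    and A': "A \<subseteq> A'" "(y, lab (arev e) * k, y') \<in> A'"
    and d: "derivable arev lab A B z l z'"
  shows "derivable arev lab A' B' z l z'"
  using d
proof (induction rule: derivable.induct)
  case (edge u e' w m)
  \<comment> \<open>The given derivation from \<open>x\<close> to \<open>x'\<close> may use the
    deleted edge, a chain of ties does not. Any exponent \<open>c\<close> will do, as stabilisers
    are constant along ties.\<close>
  obtain c where "derivable arev lab A {} x c x'" using derivable_tie_connected[OF der] by blast
  then have c: "derivable arev lab A' B' x c x'" using A'(1) derivable_mono by (metis empty_subsetI)
  have t: "derivable arev lab A' B' y (lab (arev e) * k) y'" using A'(2) by (rule derivable.tie)
  consider "(u, e', w) \<in> B'" | "(u, e', w) = (x', e, y')" | "(u, e', w) = (y', arev e, x')"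
    using edge.hyps(1) B by blast
  then show ?case
  proof cases
    case 1
    then show ?thesis using edge.IH by (rule derivable.edge)
  next
    case 2
    then have "derivable arev lab A' B' x (lab e * m) x"
      using edge.IH derivable_conj[OF derivable.sym[OF c]] by simp
    then have "derivable arev lab A' B' y (lab (arev e) * m) y" by (rule derivable.edge[OF B'(1)])
    then show ?thesis using 2 derivable_conj[OF t] by simp
  next
    case 3
    then have "derivable arev lab A' B' y (lab (arev e) * m) y"
      using edge.IH derivable_conj[OF derivable.sym[OF t]] by simp
    then have "derivable arev lab A' B' x (lab e * m) x" using derivable.edge[OF B'(2)] invol by metis
    then show ?thesis using 3 derivable_conj[OF c] invol by simp
  qed
qed (use A' in \<open>blast intro: derivable.intros\<close>)+

lemma orientation_exists:
  assumes "\<And>e. e \<in> A \<Longrightarrow> r e \<in> A" "\<And>e. e \<in> A \<Longrightarrow> r e \<noteq> e" "\<And>e. e \<in> A \<Longrightarrow> r (r e) = e"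
  shows "\<exists>E. E \<subseteq> A \<and> (\<forall>e\<in>A. (e \<in> E) \<noteq> (r e \<in> E))"
proof -
  \<comment> \<open>The choice depends only on the unordered pair, so \<open>e\<close> and
    \<open>r e\<close> select the same element.\<close>
  define c where "c e = (SOME z. z \<in> {e, r e})" for e
  have c: "c e \<in> {e, r e}" for e unfolding c_def by (rule someI[of _ e]) simp
  have cr: "c (r e) = c e" if "e \<in> A" for e
    unfolding c_def using assms(3)[OF that] by (simp add: insert_commute)
  show ?thesis
  proof (intro exI conjI ballI)
    show "{e \<in> A. c e = e} \<subseteq> A" by blast
    fix e assume e: "e \<in> A"
    then show "(e \<in> {e \<in> A. c e = e}) \<noteq> (r e \<in> {e \<in> A. c e = e})"
      using c[of e] cr[OF e] assms(1,2)[OF e] by auto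
  qed
qed

section \<open>Models, presentations of the one-point set, and folding\<close>

context labelled_graph begin

text \<open>
  Every vertex \<open>v\<close> has its own copy of \<^typ>\<open>nat\<close>, on which \<open>a\<^sub>v\<close> acts through \<open>al v\<close>, and \<open>ta e\<close> maps the
  copy of the origin of \<open>e\<close> to that of its end. The edges of the maximal subtree are not required to
  act trivially: \<open>gmodel_untwist\<close> identifies the copies along the tree.
\<close>

definition gmodel :: "('v \<Rightarrow> int \<Rightarrow> nat \<Rightarrow> nat) \<Rightarrow> ('e \<Rightarrow> nat \<Rightarrow> nat) \<Rightarrow> bool" where
  "gmodel al ta \<longleftrightarrow> (\<forall>v. zaction (al v)) \<and> (\<forall>e\<in>arcs G. \<forall>x. ta (arev e) (ta e x) = x)
    \<and> (\<forall>e\<in>arcs G. \<forall>k x. ta e (al (tail G e) (lab e * k) x) = al (head G e) (lab (arev e) * k) (ta e x))"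

definition satisfies :: "('v \<Rightarrow> int \<Rightarrow> nat \<Rightarrow> nat) \<Rightarrow> ('e \<Rightarrow> nat \<Rightarrow> nat) \<Rightarrow> ('p \<Rightarrow> 'v)
    \<Rightarrow> ('p \<times> int \<times> 'p) set \<Rightarrow> ('p \<times> 'e \<times> 'p) set \<Rightarrow> ('p \<Rightarrow> nat) \<Rightarrow> bool" where
  "satisfies al ta ty A B f \<longleftrightarrow> (\<forall>(x, k, y)\<in>A. al (ty x) k (f x) = f y) \<and> (\<forall>(x, e, y)\<in>B. ta e (f x) = f y)"

text \<open>\<open>B\<close> is closed under reversal, so each edge relation is counted twice in
  \<open>card B\<close>; this is the origin of the factors 2 in all the bounds.\<close>

definition presentation :: "('p \<Rightarrow> 'v) \<Rightarrow> 'p set \<Rightarrow> ('p \<times> int \<times> 'p) set \<Rightarrow> ('p \<times> 'e \<times> 'p) set \<Rightarrow> bool" where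
  "presentation ty P A B \<longleftrightarrow> finite P \<and> finite A \<and> finite B \<and> ty ` P = verts G
    \<and> (\<forall>(x, k, y)\<in>A. x \<in> P \<and> y \<in> P \<and> ty x = ty y)
    \<and> (\<forall>(x, e, y)\<in>B. x \<in> P \<and> y \<in> P \<and> e \<in> arcs G \<and> ty x = tail G e \<and> ty y = head G e \<and> (y, arev e, x) \<in> B)"

text \<open>The presented object is the terminal \<open>G\<close>-set, the single point: every map
  to a model has a global fixed point as its image, spread over the copies of the vertices.\<close>

definition terminal :: "('p \<Rightarrow> 'v) \<Rightarrow> 'p set \<Rightarrow> ('p \<times> int \<times> 'p) set \<Rightarrow> ('p \<times> 'e \<times> 'p) set \<Rightarrow> bool" where
  "terminal ty P A B \<longleftrightarrow> (\<forall>al ta f. gmodel al ta \<longrightarrow> satisfies al ta ty A B f \<longrightarrow>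
     (\<forall>x\<in>P. \<forall>k. al (ty x) k (f x) = f x)
   \<and> (\<forall>x\<in>P. \<forall>y\<in>P. ty x = ty y \<longrightarrow> f x = f y)
   \<and> (\<forall>e\<in>arcs G. \<forall>x\<in>P. \<forall>y\<in>P. ty x = tail G e \<longrightarrow> ty y = head G e \<longrightarrow> ta e (f x) = f y))"

abbreviation der :: "('p \<times> int \<times> 'p) set \<Rightarrow> ('p \<times> 'e \<times> 'p) set \<Rightarrow> 'p \<Rightarrow> int \<Rightarrow> 'p \<Rightarrow> bool" where
  "der \<equiv> derivable arev lab"

lemma gmodelD:
  assumes "gmodel al ta"
  shows "zaction (al v)" "e \<in> arcs G \<Longrightarrow> ta (arev e) (ta e x) = x"
    "e \<in> arcs G \<Longrightarrow> ta e (al (tail G e) (lab e * k) x) = al (head G e) (lab (arev e) * k) (ta e x)"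
  using assms unfolding gmodel_def by blast+

lemma presentation_ties:
  "presentation ty P A B \<Longrightarrow> (x, k, y) \<in> A \<Longrightarrow> x \<in> P \<and> y \<in> P \<and> ty x = ty y"
  unfolding presentation_def by blast

lemma presentation_edges:
  "presentation ty P A B \<Longrightarrow> (x, e, y) \<in> B \<Longrightarrow>
    x \<in> P \<and> y \<in> P \<and> e \<in> arcs G \<and> ty x = tail G e \<and> ty y = head G e \<and> (y, arev e, x) \<in> B"
  unfolding presentation_def by blast

lemma derivable_sound:
  assumes p: "presentation ty P A B" and m: "gmodel al ta" "satisfies al ta ty A B f"
    and d: "der A B x k y"
  shows "al (ty x) k (f x) = f y \<and> ty x = ty y"
  using d
proof (induction rule: derivable.induct)
  case (refl x)
  then show ?case using gmodelD(1)[OF m(1)] by simp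
next
  case (tie x k y)
  then show ?case using m(2) presentation_ties[OF p] unfolding satisfies_def by blast
next
  case (sym x k y)
  then show ?case using zaction_move[OF gmodelD(1)[OF m(1)]] by metis
next
  case (trans x k y l z)
  then show ?case using zaction_add[OF gmodelD(1)[OF m(1)]] by (metis add.commute)
next
  case (edge x e y k)
  have e: "e \<in> arcs G" "ty x = tail G e" "ty y = head G e" using presentation_edges[OF p edge.hyps(1)] by blast+
  have "f y = ta e (f x)" using m(2) edge.hyps(1) unfolding satisfies_def by fastforce
  then show ?case using gmodelD(3)[OF m(1) e(1), of k "f x"] edge.IH e by metis
qed

text \<open>The edge relation at \<open>x'\<close> and the new tie are equivalent given the others:
  carrying the relation between \<open>x\<close> and \<open>x'\<close> through the edge map turns
  the exponent \<open>lab e * k\<close> into \<open>lab (arev e) * k\<close>, between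
  \<open>y\<close> and the image of \<open>x'\<close>. Old and new presentation thus have the same
  models.\<close>

lemma terminal_fold:
  assumes p: "presentation ty P A B" and t: "terminal ty P A B"
    and e: "(x, e, y) \<in> B" "(x', e, y') \<in> B" "(x, e, y) \<noteq> (x', e, y')"
    and d: "der A B x (lab e * k) x'"
  defines "A' \<equiv> insert (y, lab (arev e) * k, y') A" and "B' \<equiv> B - {(x', e, y'), (y', arev e, x')}"
  shows "presentation ty P A' B'" "terminal ty P A' B'"
proof -
  note E = presentation_edges[OF p e(1)] and E' = presentation_edges[OF p e(2)]
  have neq: "arev e \<noteq> e" using E arev_neq by blast
  show p': "presentation ty P A' B'"
  proof -
    have "(w, arev d, u) \<in> B'" if "(u, d, w) \<in> B'" for u d w
      using that presentation_edges[OF p, of u d w] arev_eq_iff[of d e] arev_arev[of d] unfolding B'_def by auto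
    moreover have "B' \<subseteq> B" unfolding B'_def by blast
    moreover have "finite A'" "finite B'" "\<forall>(x, k, y)\<in>A'. x \<in> P \<and> y \<in> P \<and> ty x = ty y"
      using p E E' unfolding presentation_def A'_def B'_def by auto
    ultimately show ?thesis using p unfolding presentation_def by blast
  qed
  have B': "(x, e, y) \<in> B'" "(y, arev e, x) \<in> B'"
    using e E neq unfolding B'_def by auto
  \<comment> \<open>The relation that justified the fold must still be derivable afterwards, or the
    deleted edge could not be recovered in a model of the new presentation.\<close>
  have d': "der A' B' x (lab e * k) x'"
    by (rule derivable_fold[OF d B' _ _ _ _ d, where y' = y']) (auto simp: A'_def B'_def)
  show "terminal ty P A' B'"
    unfolding terminal_def
  proof (intro allI impI)
    fix al ta f assume m: "gmodel al ta" "satisfies al ta ty A' B' f"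
    note sound = derivable_sound[OF p' m]
    have "al (ty x) (lab e * k) (f x) = f x'" using sound[OF d'] by blast
    then have "ta e (f x') = al (ty y) (lab (arev e) * k) (ta e (f x))"
      using gmodelD(3)[OF m(1), of e k "f x"] E by metis
    also have "ta e (f x) = f y" using m(2) B'(1) unfolding satisfies_def by blast
    also have "al (ty y) (lab (arev e) * k) (f y) = f y'"
      using m(2) unfolding satisfies_def A'_def by blast
    finally have 1: "ta e (f x') = f y'" .
    then have "ta (arev e) (f y') = f x'" using gmodelD(2)[OF m(1)] E by metis
    then have "satisfies al ta ty A B f"
      using m(2) 1 unfolding satisfies_def A'_def B'_def by blast
    then show "(\<forall>x\<in>P. \<forall>k. al (ty x) k (f x) = f x)
      \<and> (\<forall>x\<in>P. \<forall>y\<in>P. ty x = ty y \<longrightarrow> f x = f y)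
      \<and> (\<forall>e\<in>arcs G. \<forall>x\<in>P. \<forall>y\<in>P. ty x = tail G e \<longrightarrow> ty y = head G e \<longrightarrow> ta e (f x) = f y)"
      using t m(1) unfolding terminal_def by blast
  qed
qed

text \<open>Derivability is complete for folded presentations. The points go to an integer action
  whose relations are exactly the derivable ones, and each edge becomes a finite matching that
  extends to a permutation.\<close>

lemma folded_model:
  assumes p: "presentation ty P A B"
    and folded: "\<And>x e y x' y' k. (x, e, y) \<in> B \<Longrightarrow> (x', e, y') \<in> B \<Longrightarrow> der A B x (lab e * k) x'
      \<Longrightarrow> x = x' \<and> y = y'"
  shows "\<exists>al ta f. gmodel al ta \<and> satisfies al ta ty A B f
    \<and> (\<forall>x\<in>P. \<forall>y\<in>P. \<forall>k. ty x = ty y \<longrightarrow> al (ty x) k (f x) = f y \<longleftrightarrow> der A B x k y)"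
proof -
  have "finite P" "finite B" using p unfolding presentation_def by blast+
  have "\<exists>(a :: int \<Rightarrow> nat \<Rightarrow> nat) f. zaction a \<and> zrich a UNIV \<and> (\<forall>x\<in>P. \<forall>y\<in>P. \<forall>k. a k (f x) = f y \<longleftrightarrow> der A B x k y)"
    by (rule zset_realization[OF \<open>finite P\<close>]) (auto intro: derivable.intros)
  then obtain a :: "int \<Rightarrow> nat \<Rightarrow> nat" and f where a: "zaction a" "zrich a UNIV"
    and f: "\<And>x y k. x \<in> P \<Longrightarrow> y \<in> P \<Longrightarrow> a k (f x) = f y \<longleftrightarrow> der A B x k y"
    by blast
  obtain E where E: "E \<subseteq> arcs G" "\<And>e. e \<in> arcs G \<Longrightarrow> (e \<in> E) \<noteq> (arev e \<in> E)"
    using orientation_exists[of "arcs G" arev] arev_neq by auto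
  have arev_folded: "x = x' \<and> y = y'"
    if "(x, e, y) \<in> B" "(x', e, y') \<in> B" "der A B y (lab (arev e) * k) y'" for x e y x' y' k
    using folded[of y "arev e" x y' x' k] that presentation_edges[OF p] by blast
  have "\<exists>\<phi>. bij \<phi> \<and> (\<forall>x k. \<phi> (a (lab e * k) x) = a (lab (arev e) * k) (\<phi> x))
      \<and> (\<forall>(x, y)\<in>(\<lambda>(x, e, y). (f x, f y)) ` {t \<in> B. fst (snd t) = e}. \<phi> x = y)" if e: "e \<in> arcs G" for e
  proof (rule zrich_extend)
    show "zaction (\<lambda>k. a (lab e * k))" "zaction (\<lambda>k. a (lab (arev e) * k))"
      using a(1) by (simp_all add: zaction_scale)
    show "zrich (\<lambda>k. a (lab e * k)) UNIV" "zrich (\<lambda>k. a (lab (arev e) * k)) UNIV"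
      using e by (auto intro!: zrich_scale a lab_nonzero)
    show "finite ((\<lambda>(x, e, y). (f x, f y)) ` {t \<in> B. fst (snd t) = e})"
      using \<open>finite B\<close> by simp
    fix u w u' w' k
    assume "(u, w) \<in> (\<lambda>(x, e, y). (f x, f y)) ` {t \<in> B. fst (snd t) = e}"
      "(u', w') \<in> (\<lambda>(x, e, y). (f x, f y)) ` {t \<in> B. fst (snd t) = e}"
    then obtain x y x' y' where xy: "(x, e, y) \<in> B" "(x', e, y') \<in> B"
      and uw: "u = f x" "w = f y" "u' = f x'" "w' = f y'" by auto
    have P: "x \<in> P" "y \<in> P" "x' \<in> P" "y' \<in> P" "(y, arev e, x) \<in> B" using presentation_edges[OF p] xy by blast+
    \<comment> \<open>Foldedness reduces either side to \<open>x = x'\<close> and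
      \<open>y = y'\<close>, and for a single pair the edge rule, used in both directions,
      identifies the two stabilisers.\<close>
    have "der A B x (lab e * k) x' \<longleftrightarrow> der A B y (lab (arev e) * k) y'"
      using folded[OF xy, of k] arev_folded[OF xy, of k] derivable.edge[OF xy(1), of arev lab A k]
        derivable.edge[OF P(5), of arev lab A k] by auto
    then show "a (lab e * k) u = u' \<longleftrightarrow> a (lab (arev e) * k) w = w'"
      using f P uw by simp
  qed
  then obtain \<phi> where \<phi>: "\<And>e. e \<in> arcs G \<Longrightarrow> bij (\<phi> e)"
    "\<And>e x k. e \<in> arcs G \<Longrightarrow> \<phi> e (a (lab e * k) x) = a (lab (arev e) * k) (\<phi> e x)"
    "\<And>x e y. e \<in> arcs G \<Longrightarrow> (x, e, y) \<in> B \<Longrightarrow> \<phi> e (f x) = f y"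
    by (metis (mono_tags, lifting) case_prodI fst_conv imageI mem_Collect_eq prod.case snd_conv case_prodD)
  \<comment> \<open>The extensions for \<open>e\<close> and \<open>arev e\<close> are chosen
    independently; keeping one per pair and inverting it makes reversal act as inversion.\<close>
  define ta where "ta e = (if e \<in> E then \<phi> e else inv_into UNIV (\<phi> (arev e)))" for e
  have inv: "inv_into UNIV (\<phi> e) (\<phi> e x) = x" "\<phi> e (inv_into UNIV (\<phi> e) x) = x" if "e \<in> arcs G" for e x
    using \<phi>(1)[OF that] by (simp_all add: bij_is_inj bij_is_surj surj_f_inv_f)
  have "gmodel (\<lambda>_. a) ta"
    unfolding gmodel_def
  proof (intro conjI allI ballI)
    fix e x k assume e: "e \<in> arcs G"
    show "ta (arev e) (ta e x) = x"
      using E(2)[OF e] inv[OF e] inv[of "arev e"] e by (auto simp: ta_def)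
    show "ta e (a (lab e * k) x) = a (lab (arev e) * k) (ta e x)"
    proof (cases "e \<in> E")
      case True
      then show ?thesis using \<phi>(2)[OF e] by (simp add: ta_def)
    next
      case False
      have "\<phi> (arev e) (a (lab (arev e) * k) (inv_into UNIV (\<phi> (arev e)) x)) = a (lab e * k) x"
        using \<phi>(2)[of "arev e"] inv(2)[of "arev e"] e by simp
      then show ?thesis using False inv(1)[of "arev e"] e by (metis arev_in_arcs ta_def)
    qed
  qed (rule a(1))
  moreover have "satisfies (\<lambda>_. a) ta ty A B f"
    unfolding satisfies_def
  proof (intro conjI ballI; clarify)
    fix x k y assume "(x, k, y) \<in> A"
    then show "a k (f x) = f y" using f presentation_ties[OF p] derivable.tie by metis
  next
    fix x e y assume xy: "(x, e, y) \<in> B"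
    note e = presentation_edges[OF p xy]
    show "ta e (f x) = f y"
    proof (cases "e \<in> E")
      case True
      then show ?thesis using \<phi>(3)[OF _ xy] e by (simp add: ta_def)
    next
      case False
      have "\<phi> (arev e) (f y) = f x" using \<phi>(3)[of "arev e" y x] e by simp
      then show ?thesis using False inv(1)[of "arev e" "f y"] e by (simp add: ta_def)
    qed
  qed
  ultimately show ?thesis using f by blast
qed

section \<open>Counting ties and edges in a folded presentation\<close>

lemma terminalD:
  assumes "terminal ty P A B" "gmodel al ta" "satisfies al ta ty A B f" "x \<in> P"
  shows "al (ty x) k (f x) = f x"
    and "y \<in> P \<Longrightarrow> ty x = ty y \<Longrightarrow> f x = f y"
    and "e \<in> arcs G \<Longrightarrow> y \<in> P \<Longrightarrow> ty x = tail G e \<Longrightarrow> ty y = head G e \<Longrightarrow> ta e (f x) = f y"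
  using assms unfolding terminal_def by simp_all

text \<open>Modulo \<open>q\<close>, nothing new is derivable over \<open>Q\<close> beyond the ties.
  An edge inside \<open>Q\<close> has labels prime to \<open>q\<close>, so it carries multiples of
  \<open>q\<close> to multiples of \<open>q\<close>; an edge coming from outside yields a multiple
  of its label at \<open>Q\<close>, which \<open>q\<close> divides.\<close>

lemma plateau_unbounded_ties:
  assumes p: "presentation ty P A B" and Q: "p_plateau q Q" and q: "prime q"
    and pos: "\<And>x k y. (x, k, y) \<in> A \<Longrightarrow> ty x \<in> verts Q \<Longrightarrow> pos y = pos x + k"
    and d: "der A B x k y" "ty x \<in> verts Q"
  shows "int q dvd pos x + k - pos y"
proof -
  have pq: "prime (int q)" using q by simp
  have Qe: "int q dvd lab e \<longleftrightarrow> e \<notin> arcs Q" if "e \<in> arcs G" "tail G e \<in> verts Q" for e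
    using Q that unfolding p_plateau_def by blast
  have sub: "subgraph Q G" and rev: "\<And>e. e \<in> arcs Q \<Longrightarrow> arev e \<in> arcs Q"
    using Q unfolding p_plateau_def serre_subgraph_def by blast+
  have tailQ: "tail G e \<in> verts Q" if "e \<in> arcs Q" for e
    using sub that wf_digraph.tail_in_verts[of Q e] unfolding subgraph_def compatible_def by simp
  have "ty x = ty y \<and> (ty x \<in> verts Q \<longrightarrow> int q dvd pos x + k - pos y)"
    using d(1)
  proof (induction rule: derivable.induct)
    case (tie x k y)
    then show ?case using pos presentation_ties[OF p] by simp
  next
    case (sym x k y)
    have "pos y + - k - pos x = - (pos x + k - pos y)" by simp
    then show ?case using sym by (metis dvd_minus_iff)
  next
    case (trans x k y l z)
    have "pos x + (k + l) - pos z = (pos x + k - pos y) + (pos y + l - pos z)" by simp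
    then show ?case using trans by (metis dvd_add)
  next
    case (edge x e y k)
    have e: "e \<in> arcs G" "ty x = tail G e" "ty y = tail G (arev e)" "arev e \<in> arcs G"
      using presentation_edges[OF p edge.hyps(1)] by simp_all
    have "int q dvd lab (arev e) * k" if y: "ty y \<in> verts Q"
    proof (cases "arev e \<in> arcs Q")
      case True
      then have eQ: "e \<in> arcs Q" using rev[of "arev e"] by simp
      then have "int q dvd lab e * k" "\<not> int q dvd lab e"
        using edge.IH e Qe[OF e(1)] tailQ by simp_all
      then show ?thesis using pq by (simp add: prime_dvd_mult_iff)
    next
      case False
      then show ?thesis using Qe[of "arev e"] e y by (metis dvd_mult2)
    qed
    then show ?case by simp
  qed simp
  then show ?thesis using d(2) by blast
qed

text \<open>Without a relation for \<open>e\<close>, its stable letter may act by any permutation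
  while everything else acts trivially.\<close>

lemma terminal_edge:
  assumes p: "presentation ty P A B" and t: "terminal ty P A B" and e: "e \<in> arcs G"
  shows "\<exists>x y. (x, e, y) \<in> B"
proof (rule ccontr)
  assume none: "\<nexists>x y. (x, e, y) \<in> B"
  then have none': "\<nexists>x y. (x, arev e, y) \<in> B"
    using presentation_edges[OF p, of _ "arev e"] by fastforce
  \<comment> \<open>The transposition is its own inverse, so one map serves both orientations; it
    moves 0, the image of all points.\<close>
  define ta :: "'e \<Rightarrow> nat \<Rightarrow> nat" where "ta d = (if d \<in> {e, arev e} then transpose 0 1 else id)" for d
  have "arev d \<in> {e, arev e} \<longleftrightarrow> d \<in> {e, arev e}" for d
    using arev_eq_iff[of d e] arev_eq_iff[of d "arev e"] by auto
  then have m: "gmodel (\<lambda>_ _ x. x) ta"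
    unfolding gmodel_def zaction_def ta_def by simp
  have sat: "satisfies (\<lambda>_ _ x. x) ta ty A B (\<lambda>_. 0)"
    using none none' unfolding satisfies_def ta_def by auto
  have "tail G e \<in> ty ` P" "head G e \<in> ty ` P" using p e unfolding presentation_def by auto
  from this(1) obtain x where x: "tail G e = ty x" "x \<in> P" by (rule imageE)
  from \<open>head G e \<in> ty ` P\<close> obtain y where y: "head G e = ty y" "y \<in> P" by (rule imageE)
  have "ta e 0 = 0" using terminalD(3)[OF t m sat x(2) e y(2)] x y by simp
  then show False by (simp add: ta_def)
qed

lemma plateaunic_number_le:
  assumes "X \<subseteq> verts G" "\<And>Q. plateau Q \<Longrightarrow> X \<inter> verts Q \<noteq> {}"
  shows "plateaunic_number \<le> card X"
  unfolding plateaunic_number_def using assms by (intro Least_le) blast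

text \<open>Twice the count of relations minus points, vertex by vertex. The ties over
  \<open>v\<close> connect all its points, so there are at least \<open>card (Pv v) - 1\<close> of
  them; \<open>X\<close> collects the vertices with more, and every edge of the graph occurs in
  \<open>B\<close>.\<close>

lemma folded_presentation_bound:
  fixes ty :: "'p \<Rightarrow> 'v"
  assumes p: "presentation ty P A B" and t: "terminal ty P A B"
    and folded: "\<And>x e y x' y' k. (x, e, y) \<in> B \<Longrightarrow> (x', e, y') \<in> B \<Longrightarrow> der A B x (lab e * k) x'
      \<Longrightarrow> x = x' \<and> y = y'"
  shows "card (arcs G) + 2 * plateaunic_number + 2 * card P \<le> 2 * card A + card B + 2 * card (verts G)"
proof -
  have fin: "finite P" "finite A" "finite B" "ty ` P = verts G" using p unfolding presentation_def by blast+
  have "\<exists>al ta f. gmodel al ta \<and> satisfies al ta ty A B f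
    \<and> (\<forall>x\<in>P. \<forall>y\<in>P. \<forall>k. ty x = ty y \<longrightarrow> al (ty x) k (f x) = f y \<longleftrightarrow> der A B x k y)"
    by (rule folded_model[OF p]) (rule folded)
  then obtain al ta f where m: "gmodel al ta" "satisfies al ta ty A B f"
    and f: "\<forall>x\<in>P. \<forall>y\<in>P. \<forall>k. ty x = ty y \<longrightarrow> al (ty x) k (f x) = f y \<longleftrightarrow> der A B x k y"
    by blast
  \<comment> \<open>Terminality collapses the points in the faithful model, so every relation
    between points over the same vertex is derivable.\<close>
  have der: "der A B x k y" if "x \<in> P" "y \<in> P" "ty x = ty y" for x k y
  proof -
    have "al (ty x) k (f x) = f y"
      using terminalD(1,2)[OF t m that(1)] that by metis
    then show ?thesis using f that by blast
  qed
  define Pv where "Pv v = {x \<in> P. ty x = v}" for v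
  define Av where "Av v = {t \<in> A. ty (fst t) = v}" for v
  define X where "X = {v \<in> verts G. card (Pv v) \<le> card (Av v)}"
  have Pv: "card (Pv v) \<le> card (Av v) + 1 \<and> (v \<notin> X \<longrightarrow> (\<exists>pos. \<forall>(x, k, y)\<in>Av v. pos y = pos x + k))"
    if v: "v \<in> verts G" for v
  proof -
    have "\<exists>comp :: 'p \<Rightarrow> 'p. (\<forall>(x, k, y)\<in>Av v. comp x = comp y) \<and> card (Pv v) \<le> card (comp ` Pv v) + card (Av v)
      \<and> (card (Pv v) = card (comp ` Pv v) + card (Av v) \<longrightarrow> (\<exists>pos. \<forall>(x, k, y)\<in>Av v. pos y = pos x + k))"
      by (rule tie_components) (use fin presentation_ties[OF p] in \<open>auto simp: Av_def Pv_def\<close>)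
    then obtain comp :: "'p \<Rightarrow> 'p" where comp: "\<forall>(x, k, y)\<in>Av v. comp x = comp y"
      "card (Pv v) \<le> card (comp ` Pv v) + card (Av v)"
      "card (Pv v) = card (comp ` Pv v) + card (Av v) \<longrightarrow> (\<exists>pos. \<forall>(x, k, y)\<in>Av v. pos y = pos x + k)"
      by blast
    have conn: "ty x = ty y \<and> (ty x = v \<longrightarrow> comp x = comp y)" if "der A {} x k y" for x k y
      using that
    proof (induction rule: derivable.induct)
      case (tie x k y)
      then show ?case using comp(1) presentation_ties[OF p] unfolding Av_def by fastforce
    qed auto
    have "comp x = comp y" if "x \<in> Pv v" "y \<in> Pv v" for x y
    proof -
      have "der A B x 0 y" using der that unfolding Pv_def by auto
      from derivable_tie_connected[OF this] obtain c where "der A {} x c y" by blast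
      then show ?thesis using conn that unfolding Pv_def by simp
    qed
    moreover have "v \<in> ty ` P" using v fin(4) by simp
    then obtain x where x: "x \<in> Pv v" unfolding Pv_def by force
    ultimately have "comp ` Pv v = {comp x}" by blast
    then show ?thesis using comp v unfolding X_def by auto
  qed
  then have "\<forall>v. \<exists>pos. v \<in> verts G \<longrightarrow> v \<notin> X \<longrightarrow> (\<forall>(x, k, y)\<in>Av v. pos y = pos x + k)" by blast
  from choice[OF this] obtain pos
    where pos: "\<And>v. v \<in> verts G \<Longrightarrow> v \<notin> X \<Longrightarrow> \<forall>(x, k, y)\<in>Av v. pos v y = pos v x + k"
    by blast
  have "X \<inter> verts Q \<noteq> {}" if Q: "plateau Q" for Q
  proof
    assume XQ: "X \<inter> verts Q = {}"
    obtain q where q: "prime q" "p_plateau q Q" using Q unfolding plateau_def by blast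
    then obtain v where v: "v \<in> verts Q" "v \<in> verts G" and QG: "verts Q \<subseteq> verts G"
      unfolding p_plateau_def serre_subgraph_def subgraph_def by blast
    have "v \<in> ty ` P" using v fin(4) by simp
    then obtain x where x: "x \<in> P" "ty x = v" by blast
    \<comment> \<open>The loop with exponent 1 at \<open>x\<close> is derivable, so a plateau missed
      by \<open>X\<close> would give a prime dividing 1.\<close>
    have "int q dvd pos (ty x) x + 1 - pos (ty x) x"
    proof (rule plateau_unbounded_ties[OF p q(2,1)])
      fix x k y assume A: "(x, k, y) \<in> A" and "ty x \<in> verts Q"
      then have "ty x \<in> verts G" "ty x \<notin> X" "(x, k, y) \<in> Av (ty x)" using XQ QG unfolding Av_def by auto
      then have "pos (ty x) y = pos (ty x) x + k" using pos by fast
      then show "pos (ty y) y = pos (ty x) x + k" using presentation_ties[OF p A] by simp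
    qed (use der x v in auto)
    then show False using q(1) by (simp add: prime_nat_iff)
  qed
  moreover have X_sub: "X \<subseteq> verts G" unfolding X_def by blast
  ultimately have "plateaunic_number \<le> card X" by (intro plateaunic_number_le)
  also have "card X = (\<Sum>v\<in>verts G. if v \<in> X then 1 else 0)"
    using Int_absorb1[of X "verts G"] by (simp add: sum.If_cases X_sub)
  finally have mu: "plateaunic_number + card P \<le> (\<Sum>v\<in>verts G. if v \<in> X then 1 else 0) + card P"
    by simp
  have "P = (\<Union>v\<in>verts G. Pv v)" using fin(4) unfolding Pv_def by blast
  moreover have "card (\<Union>v\<in>verts G. Pv v) = (\<Sum>v\<in>verts G. card (Pv v))"
    by (rule card_UN_disjoint) (use fin(1) in \<open>auto simp: Pv_def\<close>)
  ultimately have "card P = (\<Sum>v\<in>verts G. card (Pv v))" by simp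
  moreover have "card A = (\<Sum>v\<in>verts G. card (Av v))"
  proof -
    have "ty (fst t) \<in> verts G" if "t \<in> A" for t
      using that presentation_ties[OF p, of "fst t" "fst (snd t)" "snd (snd t)"] fin(4) by auto
    then have "A = (\<Union>v\<in>verts G. Av v)" unfolding Av_def by blast
    moreover have "card (\<Union>v\<in>verts G. Av v) = (\<Sum>v\<in>verts G. card (Av v))"
      by (rule card_UN_disjoint) (use fin(2) in \<open>auto simp: Av_def\<close>)
    ultimately show ?thesis by simp
  qed
  moreover have "(\<Sum>v\<in>verts G. (if v \<in> X then 1 else 0) + card (Pv v)) \<le> (\<Sum>v\<in>verts G. card (Av v) + 1)"
  proof (rule sum_mono)
    fix v assume "v \<in> verts G"
    then show "(if v \<in> X then 1 else 0) + card (Pv v) \<le> card (Av v) + 1"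
      using Pv[of v] unfolding X_def by auto
  qed
  ultimately have "plateaunic_number + card P \<le> card A + card (verts G)"
    using mu by (simp add: sum.distrib sum_Suc)
  moreover have "arcs G \<subseteq> (\<lambda>t. fst (snd t)) ` B" using terminal_edge[OF p t] by force
  then have "card (arcs G) \<le> card B" using fin(3) by (meson card_image_le card_mono finite_imageI le_trans)
  ultimately show ?thesis by simp
qed

text \<open>A fold removes two triples from \<open>B\<close> and adds at most one to
  \<open>A\<close>, so the right-hand side does not grow, and \<open>card B\<close> decreases until
  the presentation is folded.\<close>

lemma presentation_bound:
  assumes "presentation ty P A B" "terminal ty P A B"
  shows "card (arcs G) + 2 * plateaunic_number + 2 * card P \<le> 2 * card A + card B + 2 * card (verts G)"
  using assms
proof (induction "card B" arbitrary: A B rule: less_induct)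
  case less
  show ?case
  proof (cases "\<exists>x e y x' y' k. (x, e, y) \<in> B \<and> (x', e, y') \<in> B \<and> der A B x (lab e * k) x' \<and> \<not> (x = x' \<and> y = y')")
    case False
    show ?thesis by (rule folded_presentation_bound[OF less.prems]) (use False in metis)
  next
    case True
    then obtain x e y x' y' k where e: "(x, e, y) \<in> B" "(x', e, y') \<in> B" "(x, e, y) \<noteq> (x', e, y')"
      and d: "der A B x (lab e * k) x'" by blast
    define A' where "A' = insert (y, lab (arev e) * k, y') A"
    define B' where "B' = B - {(x', e, y'), (y', arev e, x')}"
    note fold = terminal_fold[OF less.prems e d, folded A'_def B'_def]
    have fin: "finite A" "finite B" using less.prems unfolding presentation_def by blast+
    have eB: "e \<in> arcs G" "(y', arev e, x') \<in> B" using presentation_edges[OF less.prems(1) e(2)] by blast+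
    have "(x', e, y') \<noteq> (y', arev e, x')" using arev_neq[OF eB(1)] by (metis prod.inject)
    then have "card {(x', e, y'), (y', arev e, x')} = 2" by simp
    moreover have "{(x', e, y'), (y', arev e, x')} \<subseteq> B" using e(2) eB(2) by simp
    ultimately have "card B = card B' + 2"
      unfolding B'_def using fin(2) card_mono[OF fin(2), of "{(x', e, y'), (y', arev e, x')}"]
      by (simp add: card_Diff_subset)
    moreover have "card A' \<le> card A + 1" unfolding A'_def using fin(1) by (simp add: card_insert_if)
    ultimately show ?thesis using less.hyps[OF _ fold] by linarith
  qed
qed

end

section \<open>Trees and the first Betti number\<close>

context bidirected_digraph begin

text \<open>A constructive form of finite subtrees, for induction over leaves; the definition of
  \<open>subtree\<close> through cycles offers none. \<open>F\<close> contains both orientations of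
  every edge.\<close>

inductive grown :: "'a set \<Rightarrow> 'b set \<Rightarrow> bool" where
  single: "v \<in> verts G \<Longrightarrow> grown {v} {}"
| leaf: "grown W F \<Longrightarrow> e \<in> arcs G \<Longrightarrow> tail G e \<in> W \<Longrightarrow> head G e \<notin> W \<Longrightarrow>
    grown (insert (head G e) W) (F \<union> {e, arev e})"

lemma grown_finite: "grown W F \<Longrightarrow> finite W \<and> finite F"
  by (induction rule: grown.induct) auto

lemma grown_subset: "grown W F \<Longrightarrow> W \<subseteq> verts G \<and> F \<subseteq> arcs G"
  by (induction rule: grown.induct) auto

lemma grown_arcs: "grown W F \<Longrightarrow> e \<in> F \<Longrightarrow> e \<in> arcs G \<and> tail G e \<in> W \<and> head G e \<in> W \<and> arev e \<in> F"
  by (induction arbitrary: e rule: grown.induct) auto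

lemma grown_card: "grown W F \<Longrightarrow> card F + 2 = 2 * card W"
proof (induction rule: grown.induct)
  case (leaf W F e)
  have "e \<notin> F" "arev e \<notin> F" using grown_arcs[OF leaf.hyps(1)] leaf.hyps by fastforce+
  moreover have "arev e \<noteq> e" using arev_neq leaf.hyps by blast
  ultimately show ?case using grown_finite[OF leaf.hyps(1)] leaf.IH leaf.hyps by simp
qed simp

lemma cas_append_ex: "cas u (p @ q) w \<longleftrightarrow> (\<exists>v. cas u p v \<and> cas v q w)"
  by (induction p arbitrary: u) auto

lemma awalk_verts_heads: "cas u p v \<Longrightarrow> awalk_verts u p = u # map (head G) p"
  by (induction p arbitrary: u) auto

lemma grown_walk:
  "grown W F \<Longrightarrow> u \<in> W \<Longrightarrow> v \<in> W \<Longrightarrow> \<exists>p. set p \<subseteq> F \<and> cas u p v"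
proof (induction arbitrary: u v rule: grown.induct)
  case (single w)
  then show ?case by (intro exI[of _ "[]"]) simp
next
  case (leaf W F e)
  have step: "\<exists>p. set p \<subseteq> F \<union> {e, arev e} \<and> cas u p v" if u: "u \<in> insert (head G e) W" and v: "v \<in> W" for u v
  proof (cases "u \<in> W")
    case True
    then show ?thesis using leaf.IH[OF True v] by blast
  next
    case False
    then have u: "u = head G e" using u by simp
    obtain p where "set p \<subseteq> F" "cas (tail G e) p v" using leaf.IH[OF leaf.hyps(3) v] by blast
    then show ?thesis using u leaf.hyps by (intro exI[of _ "arev e # p"]) auto
  qed
  show ?case
  proof (cases "v \<in> W")
    case True
    then show ?thesis using step leaf.prems by blast
  next
    case False
    then have v: "v = head G e" using leaf.prems by simp
    obtain p where p: "set p \<subseteq> F \<union> {e, arev e}" "cas u p (tail G e)" using step[OF leaf.prems(1) leaf.hyps(3)] by blast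
    have "cas u (p @ [e]) v" unfolding cas_append_ex using p(2) v by auto
    then show ?thesis using p(1) by (intro exI[of _ "p @ [e]"]) auto
  qed
qed

lemma connected_cut:
  assumes H: "subgraph H G" "\<And>e. e \<in> arcs H \<Longrightarrow> arev e \<in> arcs H" "Digraph_Component.connected H"
    and W: "W \<subseteq> verts H" "W \<noteq> {}" "W \<noteq> verts H"
  shows "\<exists>e\<in>arcs H. tail G e \<in> W \<and> head G e \<notin> W"
proof (rule ccontr)
  assume none: "\<not> (\<exists>e\<in>arcs H. tail G e \<in> W \<and> head G e \<notin> W)"
  have ends: "tail H = tail G" "head H = head G" "arcs H \<subseteq> arcs G"
    using H(1) unfolding subgraph_def compatible_def by auto
  obtain u v where uv: "u \<in> W" "v \<in> verts H" "v \<notin> W" using W by blast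
  then have "(u, v) \<in> rtrancl_on (verts H) ((arcs_ends H)\<^sup>s)"
    using H(3) W(1) unfolding connected_conv by blast
  then have "v \<in> W"
  proof (induction rule: rtrancl_on_induct)
    case (step y z)
    then consider "(y, z) \<in> arcs_ends H" | "(z, y) \<in> arcs_ends H" unfolding symcl_def by auto
    then show ?case
    proof cases
      case 1
      then obtain e where "e \<in> arcs H" "tail G e = y" "head G e = z" using ends by (auto elim: reachableE)
      then show ?thesis using none step by blast
    next
      case 2
      then obtain e where e: "e \<in> arcs H" "tail G e = z" "head G e = y" using ends by (auto elim: reachableE)
      then have "arev e \<in> arcs H" "tail G (arev e) = y" "head G (arev e) = z" using H(2) ends by auto
      then show ?thesis using none step by blast
    qed
  qed (use uv in simp)
  then show False using uv by simp
qed

definition part :: "'a set \<Rightarrow> 'b set \<Rightarrow> ('a, 'b) pre_digraph" where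
  "part W F = \<lparr>verts = W, arcs = F, tail = tail G, head = head G\<rparr>"

lemma part_simps [simp]:
  "verts (part W F) = W" "arcs (part W F) = F" "tail (part W F) = tail G" "head (part W F) = head G"
  by (simp_all add: part_def)

lemma part_cas [simp]: "pre_digraph.cas (part W F) = cas"
  "pre_digraph.awalk_verts (part W F) = awalk_verts"
  by (rule compatible_cas compatible_awalk_verts; simp add: compatible_def)+

lemma part_serre_subgraph:
  assumes "W \<subseteq> verts G" "F \<subseteq> arcs G" "\<And>e. e \<in> F \<Longrightarrow> tail G e \<in> W \<and> head G e \<in> W \<and> arev e \<in> F"
  shows "serre_subgraph (part W F)"
  unfolding serre_subgraph_def subgraph_def compatible_def
  using assms by (auto intro!: wf_digraph.intro wf_digraph)

lemma part_connected:
  assumes "serre_subgraph (part W F)" "W \<noteq> {}"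
    and walk: "\<And>u v. u \<in> W \<Longrightarrow> v \<in> W \<Longrightarrow> \<exists>p. set p \<subseteq> F \<and> cas u p v"
  shows "Digraph_Component.connected (part W F)"
proof -
  interpret H: wf_digraph "part W F"
    using assms(1) unfolding serre_subgraph_def subgraph_def by blast
  show ?thesis
    unfolding connected_def
  proof (rule strongly_connectedI)
    fix u v assume "u \<in> verts (with_proj (mk_symmetric (part W F)))" "v \<in> verts (with_proj (mk_symmetric (part W F)))"
    then have uv: "u \<in> W" "v \<in> W" by simp_all
    obtain p where "set p \<subseteq> F" "cas u p v" using walk[OF uv] by blast
    then have "H.awalk u p v" using uv by (simp add: H.awalk_def)
    then have "u \<rightarrow>\<^sup>*\<^bsub>part W F\<^esub> v" by (rule H.reachable_awalkI)
    then show "u \<rightarrow>\<^sup>*\<^bsub>with_proj (mk_symmetric (part W F))\<^esub> v" by (rule H.reachable_mk_symmetricI)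
  qed (use assms(2) in simp)
qed

text \<open>A closed walk through the new leaf without repeated vertices is the backtracking \<open>[e, arev e]\<close>.\<close>

lemma grown_cycle:
  "grown W F \<Longrightarrow> cas u p u \<Longrightarrow> set p \<subseteq> F \<Longrightarrow> distinct (tl (awalk_verts u p)) \<Longrightarrow> p \<noteq> [] \<Longrightarrow>
    \<exists>e. p = [e, arev e]"
proof (induction arbitrary: u p rule: grown.induct)
  case (leaf W F e)
  have F: "tail G d \<in> W" "head G d \<in> W" "d \<in> arcs G" if "d \<in> F" for d
    using grown_arcs[OF leaf.hyps(1) that] by blast+
  have heads: "distinct (map (head G) p)" using leaf.prems(1,3) awalk_verts_heads by simp
  have tail_e: "d = arev e" if "d \<in> F \<union> {e, arev e}" "tail G d = head G e" for d
    using that F(1)[of d] leaf.hyps by auto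
  have head_e: "d = e" if "d \<in> F \<union> {e, arev e}" "head G d = head G e" for d
    using that F(2)[of d] leaf.hyps by auto
  have last_head: "q = [] \<or> head G (last q) = w" if "cas v q w" for v q w
    using that by (induction q arbitrary: v) auto
  \<comment> \<open>At the leaf the only arc in is \<open>e\<close> and the only arc out is
    \<open>arev e\<close>. A closed walk through \<open>arev e\<close> must therefore also enter by
    \<open>e\<close>, which excludes the third case.\<close>
  consider "e \<notin> set p" "arev e \<notin> set p" | "e \<in> set p" | "arev e \<in> set p" "e \<notin> set p" by blast
  then show ?case
  proof cases
    case 1
    then show ?thesis using leaf.IH leaf.prems by blast
  next
    case 2
    then obtain q r where p: "p = q @ e # r" by (metis split_list)
    obtain w where w: "cas u q w" "cas w (e # r) u" using cas_append_ex leaf.prems(1) p by metis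
    \<comment> \<open>A nonempty \<open>s\<close> would enter \<open>tail G e\<close>, which
      \<open>arev e\<close> enters too, although a cycle has distinct heads.\<close>
    have dup: "s = []" if "cas v s (tail G e)" "arev e \<in> set t" "distinct (map (head G) (s @ t)) \<or> distinct (map (head G) (t @ s))" for v s t
    proof (rule ccontr)
      assume "s \<noteq> []"
      then have "head G (last s) = head G (arev e)" using last_head[OF that(1)] leaf.hyps by simp
      moreover have "last s \<in> set s" using \<open>s \<noteq> []\<close> by simp
      ultimately show False using that(2,3) by auto
    qed
    show ?thesis
    proof (cases r)
      case Nil
      then have u: "u = head G e" "w = tail G e" using w by auto
      then have "q \<noteq> []" using w(1) leaf.hyps by auto
      then obtain d q' where q: "q = d # q'" by (cases q) auto
      then have "tail G d = head G e" using w(1) u by simp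
      then have d: "d = arev e" using tail_e q p leaf.prems(2) by simp
      have "cas (tail G e) q' (tail G e)" using w(1) q d u leaf.hyps by simp
      then have "q' = []" using dup[of _ q' "[d]"] heads p q d by simp
      then show ?thesis using p q d Nil by (intro exI[of _ "arev e"]) simp
    next
      case (Cons d r')
      then have "tail G d = head G e" using w(2) by simp
      then have d: "d = arev e" using tail_e p Cons leaf.prems(2) by simp
      have w': "cas u q (tail G e)" "cas (tail G e) r' u" using w Cons d leaf.hyps by auto
      have "q = []" using dup[OF w'(1), of "arev e # r'"] heads p Cons d by simp
      moreover from this have "r' = []" using dup[of _ r' "[arev e]"] w' heads p Cons d by simp
      ultimately show ?thesis using p Cons d by (intro exI[of _ e]) simp
    qed
  next
    case 3
    then obtain q r where p: "p = q @ arev e # r" by (metis split_list)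
    obtain w where w: "cas u q w" "cas w (arev e # r) u" using cas_append_ex leaf.prems(1) p by metis
    have "w = head G e" using w(2) leaf.hyps by simp
    have False
    proof (cases "q = []")
      case False
      then have "head G (last q) = head G e" using last_head[OF w(1)] \<open>w = head G e\<close> by simp
      moreover have "last q \<in> set p" using False p by simp
      ultimately have "last q = e" using head_e leaf.prems(2) by blast
      then show False using 3(2) \<open>last q \<in> set p\<close> by simp
    next
      case True
      then have u: "u = head G e" using w \<open>w = head G e\<close> by simp
      have "r \<noteq> []" using w(2) u leaf.hyps by auto
      then have "head G (last r) = head G e" using w(2) u last_head[of _ r u] by auto
      moreover have "last r \<in> set p" using \<open>r \<noteq> []\<close> p by simp
      ultimately have "last r = e" using head_e leaf.prems(2) by blast
      then show False using 3(2) \<open>last r \<in> set p\<close> by simp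
    qed
    then show ?thesis ..
  qed
qed simp

lemma grown_subtree:
  assumes "grown W F"
  shows "subtree (part W F)"
proof -
  have s: "serre_subgraph (part W F)"
    using grown_subset[OF assms] grown_arcs[OF assms] by (intro part_serre_subgraph) blast+
  have "W \<noteq> {}" using assms by (cases rule: grown.cases) auto
  then have "Digraph_Component.connected (part W F)"
    using s grown_walk[OF assms] by (intro part_connected)
  moreover have "\<exists>e. p = [e, arev e]" if "pre_digraph.cycle (part W F) p" for p
    using that grown_cycle[OF assms]
    unfolding pre_digraph.cycle_def pre_digraph.awalk_def by auto
  ultimately show ?thesis using s unfolding subtree_def by blast
qed

lemma grown_exhausts:
  assumes H: "serre_subgraph H" "Digraph_Component.connected H" "finite (verts H)"
  shows "\<exists>F. F \<subseteq> arcs H \<and> grown (verts H) F"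
proof -
  have sub: "subgraph H G" "\<And>e. e \<in> arcs H \<Longrightarrow> arev e \<in> arcs H" using H(1) unfolding serre_subgraph_def by blast+
  have VH: "verts H \<subseteq> verts G" "arcs H \<subseteq> arcs G" "\<And>e. e \<in> arcs H \<Longrightarrow> head G e \<in> verts H"
    using sub(1) wf_digraph.head_in_verts[of H] unfolding subgraph_def compatible_def by auto
  have ne: "verts H \<noteq> {}" using H(2) unfolding connected_conv by blast
  have "\<exists>W F. W \<subseteq> verts H \<and> F \<subseteq> arcs H \<and> grown W F \<and> card W = Suc n" if "Suc n \<le> card (verts H)" for n
    using that
  proof (induction n)
    case 0
    obtain v where "v \<in> verts H" using ne by blast
    then show ?case using VH grown.single[of v] by (intro exI[of _ "{v}"] exI[of _ "{}"]) auto
  next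
    case (Suc n)
    then obtain W F where WF: "W \<subseteq> verts H" "F \<subseteq> arcs H" "grown W F" "card W = Suc n" by auto
    then have "W \<noteq> verts H" "W \<noteq> {}" using Suc.prems by auto
    then obtain e where e: "e \<in> arcs H" "tail G e \<in> W" "head G e \<notin> W"
      using connected_cut[OF sub H(2) WF(1)] by blast
    then have "grown (insert (head G e) W) (F \<union> {e, arev e})" using WF(3) VH by (intro grown.leaf) auto
    then show ?case
      using WF e sub(2) VH grown_finite[OF WF(3)]
      by (intro exI[of _ "insert (head G e) W"] exI[of _ "F \<union> {e, arev e}"]) auto
  qed
  from this[of "card (verts H) - 1"] ne H(3) obtain W F where
    WF: "W \<subseteq> verts H" "F \<subseteq> arcs H" "grown W F" "card W = card (verts H)"
    by (metis Suc_diff_1 card_gt_0_iff order_refl)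
  then have "W = verts H" using H(3) card_subset_eq by metis
  then show ?thesis using WF by blast
qed

text \<open>A spanning tree \<open>F\<close> of \<open>T\<close> is all of \<open>T\<close>: an arc
  outside \<open>F\<close> and a path in \<open>F\<close> back to its origin form a cycle. If this
  is a backtracking, then the reverse of the arc is in \<open>F\<close>, hence so is the
  arc.\<close>

lemma subtree_grown:
  assumes T: "subtree T" "finite (verts T)"
  shows "grown (verts T) (arcs T)"
proof -
  have s: "serre_subgraph T" and conn: "Digraph_Component.connected T"
    and cyc: "\<And>p. pre_digraph.cycle T p \<Longrightarrow> \<exists>e. p = [e, arev e]"
    using T(1) unfolding subtree_def by blast+
  then obtain F where F: "F \<subseteq> arcs T" "grown (verts T) F" using grown_exhausts T(2) by blast
  interpret T: wf_digraph T using s unfolding serre_subgraph_def subgraph_def by blast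
  have "compatible G T" using s unfolding serre_subgraph_def subgraph_def by blast
  then have eqs: "T.cas = cas" "T.awalk_verts = awalk_verts" "tail T = tail G" "head T = head G"
    using compatible_cas compatible_awalk_verts compatible_tail compatible_head by metis+
  have "f \<in> F" if f: "f \<in> arcs T" for f
  proof (rule ccontr)
    assume nf: "f \<notin> F"
    have ends: "head G f \<in> verts T" "tail G f \<in> verts T"
      using T.head_in_verts[OF f] T.tail_in_verts[OF f] eqs by simp_all
    then obtain p where p: "set p \<subseteq> F" "cas (head G f) p (tail G f)"
      using grown_walk[OF F(2)] by blast
    then have "T.awalk (head G f) p (tail G f)" using F(1) ends unfolding T.awalk_def eqs by auto
    then have q: "T.apath (head G f) (T.awalk_to_apath p) (tail G f)"
      "set (T.awalk_to_apath p) \<subseteq> F"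
      using T.apath_awalk_to_apath T.awalk_to_apath_subset p(1) by blast+
    then have "T.cycle (f # T.awalk_to_apath p)"
      using f ends unfolding T.cycle_def T.apath_def T.awalk_Cons_iff
      by (intro exI[of _ "tail G f"]) (auto simp: eqs T.awalk_verts.simps[unfolded eqs] T.awalk_Cons_iff)
    then obtain e where "f # T.awalk_to_apath p = [e, arev e]" using cyc by blast
    then have "arev f \<in> F" using q(2) by auto
    then show False using nf grown_arcs[OF F(2)] by (metis arev_arev)
  qed
  then have "F = arcs T" using F(1) by blast
  then show ?thesis using F(2) by simp
qed

text \<open>A subtree missing a vertex could be enlarged by an edge leaving it, so a maximal one
  spans.\<close>

lemma maximal_subtree_grown:
  assumes "Digraph_Component.connected G" "finite (verts G)" "maximal_subtree T"
  shows "grown (verts G) (arcs T)"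
proof -
  have T: "subgraph T G" "subtree T"
    "\<And>H. H \<noteq> T \<Longrightarrow> subgraph T H \<Longrightarrow> subgraph H G \<Longrightarrow> \<not> subtree H"
    using assms(3) unfolding maximal_subtree_def max_subgraph_def by blast+
  have sub: "verts T \<subseteq> verts G" "wf_digraph T" "compatible G T" using T(1) unfolding subgraph_def by blast+
  have g: "grown (verts T) (arcs T)" using subtree_grown[OF T(2)] sub assms(2) finite_subset by blast
  have "verts T = verts G"
  proof (rule ccontr)
    assume ne: "verts T \<noteq> verts G"
    have "verts T \<noteq> {}" using g by (cases rule: grown.cases) auto
    moreover have "subgraph G G" using wf_digraph unfolding subgraph_def compatible_def by simp
    ultimately have "\<exists>e\<in>arcs G. tail G e \<in> verts T \<and> head G e \<notin> verts T"
      using connected_cut[OF _ arev_in_arcs assms(1) sub(1) _ ne] by blast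
    then obtain e where e: "e \<in> arcs G" "tail G e \<in> verts T" "head G e \<notin> verts T" by blast
    define H where "H = part (insert (head G e) (verts T)) (arcs T \<union> {e, arev e})"
    have "subtree H" unfolding H_def by (rule grown_subtree[OF grown.leaf[OF g e]])
    moreover have "subgraph H G" using \<open>subtree H\<close> unfolding subtree_def serre_subgraph_def by blast
    moreover have "subgraph T H"
    proof -
      have "verts T \<subseteq> verts H" "arcs T \<subseteq> arcs H" unfolding H_def by auto
      then show ?thesis using sub \<open>subgraph H G\<close> unfolding subgraph_def compatible_def by simp
    qed
    moreover have "verts H \<noteq> verts T" using e(3) unfolding H_def by auto
    then have "H \<noteq> T" by blast
    ultimately show False using T(3) by blast
  qed
  then show ?thesis using g by simp
qed

text \<open>Edge maps over a tree can be trivialised: \<open>c v\<close> identifies the copy at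
  \<open>v\<close> with a common one, and \<open>d v\<close> is its inverse. At a new leaf,
  \<open>c\<close> is forced by its value at the other end of the edge.\<close>

lemma grown_potential:
  fixes ta :: "'b \<Rightarrow> 'x \<Rightarrow> 'x"
  assumes inv: "\<And>e x. e \<in> arcs G \<Longrightarrow> ta (arev e) (ta e x) = x"
  shows "grown W F \<Longrightarrow> \<exists>(c :: 'a \<Rightarrow> 'x \<Rightarrow> 'x) d. (\<forall>v x. c v (d v x) = x \<and> d v (c v x) = x)
    \<and> (\<forall>e\<in>F. \<forall>x. c (head G e) (ta e x) = c (tail G e) x)"
proof (induction rule: grown.induct)
  case (single v)
  show ?case by (intro exI[of _ "\<lambda>_ x. x"]) simp
next
  case (leaf W F e)
  then obtain c d :: "'a \<Rightarrow> 'x \<Rightarrow> 'x" where c: "\<And>v x. c v (d v x) = x" "\<And>v x. d v (c v x) = x"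
    "\<And>e x. e \<in> F \<Longrightarrow> c (head G e) (ta e x) = c (tail G e) x" by blast
  let ?c = "c(head G e := c (tail G e) \<circ> ta (arev e))"
  let ?d = "d(head G e := ta e \<circ> d (tail G e))"
  have F: "tail G f \<noteq> head G e" "head G f \<noteq> head G e" if "f \<in> F" for f
    using grown_arcs[OF leaf.hyps(1) that] leaf.hyps by auto
  have te: "tail G e \<noteq> head G e" using leaf.hyps by auto
  have inv': "ta e (ta (arev e) x) = x" for x using inv[of "arev e"] leaf.hyps by simp
  have "?c v (?d v x) = x \<and> ?d v (?c v x) = x" for v x
    using c inv[OF leaf.hyps(2)] inv' by auto
  moreover have "?c (head G f) (ta f x) = ?c (tail G f) x" if "f \<in> F \<union> {e, arev e}" for f x
    using that c(3) F te inv[OF leaf.hyps(2)] leaf.hyps by auto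
  ultimately show ?case by blast
qed

section \<open>Flows on trees and the basis of fundamental cycles\<close>

lemma antisymmetric_sum:
  fixes f :: "'b \<Rightarrow> rat"
  assumes "\<And>e. e \<in> F \<Longrightarrow> arev e \<in> F" "\<And>e. e \<in> F \<Longrightarrow> f (arev e) = - f e"
  shows "(\<Sum>e\<in>F. f e) = 0"
proof -
  have "(\<Sum>e\<in>F. f e) = (\<Sum>e\<in>F. f (arev e))"
    by (rule sum.reindex_bij_witness[of _ arev arev]) (use assms(1) in auto)
  also have "\<dots> = - (\<Sum>e\<in>F. f e)" using assms(2) by (simp add: sum_negf)
  finally show ?thesis by simp
qed

lemma grown_leaf_star:
  assumes g: "grown W F" and e: "e \<in> arcs G" "tail G e \<in> W" "head G e \<notin> W"
  shows "{d \<in> F \<union> {e, arev e}. tail G d = v}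
    = (if v = head G e then {arev e} else if v = tail G e then insert e {d \<in> F. tail G d = v}
       else {d \<in> F. tail G d = v})"
  using e by (auto dest: grown_arcs[OF g])

text \<open>On a tree every assignment of total 0 is the divergence of a flow: the demand of a leaf
  is sent through its only edge.\<close>

lemma grown_flow_exists:
  fixes d :: "'a \<Rightarrow> rat"
  shows "grown W F \<Longrightarrow> (\<Sum>v\<in>W. d v) = 0 \<Longrightarrow> \<exists>g. (\<forall>e. e \<notin> F \<longrightarrow> g e = 0)
    \<and> (\<forall>e\<in>F. g (arev e) = - g e) \<and> (\<forall>v\<in>W. (\<Sum>e | e \<in> F \<and> tail G e = v. g e) = d v)"
proof (induction arbitrary: d rule: grown.induct)
  case (single v)
  then show ?case by (intro exI[of _ "\<lambda>_. 0"]) simp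
next
  case (leaf W F e)
  note fin = grown_finite[OF leaf.hyps(1)]
  let ?u = "tail G e" and ?v = "head G e"
  have uv: "?u \<noteq> ?v" using leaf.hyps by auto
  have F: "e \<notin> F" "arev e \<notin> F" using grown_arcs[OF leaf.hyps(1)] leaf.hyps by fastforce+
  have ne: "arev e \<noteq> e" using arev_neq leaf.hyps by blast
  \<comment> \<open>The demand of the new leaf is charged to its neighbour, which keeps the total on
    the smaller tree at 0.\<close>
  define d' where "d' = d(?u := d ?u + d ?v)"
  have "(\<Sum>w\<in>W. d' w) = d' ?u + (\<Sum>w\<in>W - {?u}. d' w)"
    using fin leaf.hyps by (simp add: sum.remove)
  also have "(\<Sum>w\<in>W - {?u}. d' w) = (\<Sum>w\<in>W - {?u}. d w)" by (rule sum.cong) (auto simp: d'_def)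
  also have "d' ?u + \<dots> = d ?v + (d ?u + (\<Sum>w\<in>W - {?u}. d w))" by (simp add: d'_def)
  also have "d ?u + (\<Sum>w\<in>W - {?u}. d w) = (\<Sum>w\<in>W. d w)"
    using fin leaf.hyps by (simp add: sum.remove)
  also have "d ?v + \<dots> = 0" using leaf.prems fin leaf.hyps by simp
  finally obtain g where g: "\<And>f. f \<notin> F \<Longrightarrow> g f = 0" "\<And>f. f \<in> F \<Longrightarrow> g (arev f) = - g f"
    "\<And>w. w \<in> W \<Longrightarrow> (\<Sum>f | f \<in> F \<and> tail G f = w. g f) = d' w"
    using leaf.IH by blast
  define g' where "g' = g(e := - d ?v, arev e := d ?v)"
  have g'F: "g' f = g f" if "f \<in> F" for f using that F unfolding g'_def by auto
  have "g' (arev f) = - g' f" if "f \<in> F \<union> {e, arev e}" for f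
  proof (cases "f \<in> F")
    case True
    then show ?thesis using g'F g(2) grown_arcs[OF leaf.hyps(1)] by simp
  next
    case False
    then show ?thesis using that ne unfolding g'_def by auto
  qed
  moreover have "(\<Sum>f | f \<in> F \<union> {e, arev e} \<and> tail G f = w. g' f) = d w"
    if w: "w \<in> insert ?v W" for w
  proof -
    have star: "(\<Sum>f | f \<in> F \<and> tail G f = w. g' f) = d' w" if "w \<in> W"
      using g(3)[OF that] g'F by (simp cong: sum.cong_simp)
    consider "w = ?v" | "w = ?u" | "w \<in> W" "w \<noteq> ?u" "w \<noteq> ?v" using w by blast
    then show ?thesis
    proof cases
      case 1
      then show ?thesis unfolding grown_leaf_star[OF leaf.hyps] by (simp add: g'_def)
    next
      case 2
      have "(\<Sum>f\<in>insert e {f \<in> F. tail G f = w}. g' f) = g' e + d' w"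
        using F fin star 2 leaf.hyps by simp
      also have "\<dots> = d w" using ne 2 by (simp add: g'_def d'_def)
      finally show ?thesis using uv 2 unfolding grown_leaf_star[OF leaf.hyps] by simp
    next
      case 3
      then show ?thesis using star unfolding grown_leaf_star[OF leaf.hyps] by (simp add: d'_def)
    qed
  qed
  moreover have "g' f = 0" if "f \<notin> F \<union> {e, arev e}" for f using that g(1) unfolding g'_def by auto
  ultimately show ?case by blast
qed

text \<open>A tree carries no nonzero cycle: the only edge at a leaf must have value 0, and the leaf
  can be removed.\<close>

lemma grown_flow_zero:
  fixes g :: "'b \<Rightarrow> rat"
  shows "grown W F \<Longrightarrow> (\<And>e. e \<in> F \<Longrightarrow> g (arev e) = - g e)
    \<Longrightarrow> (\<And>v. v \<in> W \<Longrightarrow> (\<Sum>e | e \<in> F \<and> tail G e = v. g e) = 0) \<Longrightarrow> e \<in> F \<Longrightarrow> g e = 0"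
proof (induction arbitrary: e rule: grown.induct)
  case (leaf W F d)
  note star = grown_leaf_star[OF leaf.hyps]
  have F: "d \<notin> F" using grown_arcs[OF leaf.hyps(1)] leaf.hyps by fastforce
  have "g (arev d) = 0" using leaf.prems(2)[of "head G d"] unfolding star by simp
  moreover from this have d: "g d = 0" using leaf.prems(1)[of d] by simp
  moreover have "g f = 0" if "f \<in> F" for f
  proof (rule leaf.IH[OF _ _ that])
    fix v assume v: "v \<in> W"
    then have "v \<noteq> head G d" using leaf.hyps by blast
    then show "(\<Sum>f | f \<in> F \<and> tail G f = v. g f) = 0"
      using leaf.prems(2)[of v] v d F grown_finite[OF leaf.hyps(1)] unfolding star
      by (auto split: if_splits)
  qed (use leaf.prems(1) in blast)
  ultimately show ?case using leaf.prems(3) by blast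
qed simp

lemma out_arcs_Collect: "out_arcs G v = {e \<in> arcs G. tail G e = v}"
  by auto

text \<open>The fundamental cycles form a basis: each edge outside the tree closes up through the
  tree to a cycle, and a cycle is determined by its values on \<open>E\<close>.\<close>

lemma betti_grown:
  assumes fin: "finite (arcs G)" and g: "grown (verts G) F"
    and E: "E \<subseteq> arcs G - F" "\<And>e. e \<in> arcs G - F \<Longrightarrow> (e \<in> E) \<noteq> (arev e \<in> E)"
  shows "first_betti_number = card E"
proof -
  interpret vs: vector_space "\<lambda>(c::rat) f (e::'b). c * f e" by (rule vector_space_rat_fun)
  have F: "F \<subseteq> arcs G" "finite (verts G)" using grown_subset[OF g] grown_finite[OF g] by blast+
  have rF: "arev e \<in> F \<longleftrightarrow> e \<in> F" for e using grown_arcs[OF g, of e] grown_arcs[OF g, of "arev e"] by auto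
  have finE: "finite E" using E(1) fin finite_subset by blast
  have split: "(\<Sum>e\<in>out_arcs G v. f e) = (\<Sum>e | e \<in> F \<and> tail G e = v. f e)
      + (\<Sum>e | e \<in> arcs G - F \<and> tail G e = v. f e)" for f :: "'b \<Rightarrow> rat" and v
  proof -
    have "out_arcs G v = {e. e \<in> F \<and> tail G e = v} \<union> {e. e \<in> arcs G - F \<and> tail G e = v}" using F(1) by auto
    then show ?thesis using fin F(1) by (simp add: sum.union_disjoint finite_subset disjoint_iff)
  qed
  have cyc_eq0: "f = 0" if f: "f \<in> cycle_space" and 0: "\<And>e. e \<in> E \<Longrightarrow> f e = 0" for f
  proof -
    have out: "f e = 0" if "e \<in> arcs G - F" for e
      using E(2)[OF that] 0[of e] 0[of "arev e"] f that unfolding cycle_space_def by force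
    have "f e = 0" if "e \<in> F" for e
    proof (rule grown_flow_zero[OF g _ _ that])
      fix v assume "v \<in> verts G"
      then have "(\<Sum>e\<in>out_arcs G v. f e) = 0" using f unfolding cycle_space_def by blast
      moreover have "(\<Sum>e | e \<in> arcs G - F \<and> tail G e = v. f e) = 0" using out by (intro sum.neutral) blast
      ultimately show "(\<Sum>e | e \<in> F \<and> tail G e = v. f e) = 0" using split[of f v] by simp
    qed (use f F(1) in \<open>auto simp: cycle_space_def\<close>)
    moreover have "f e = 0" if "e \<notin> arcs G" for e using f that unfolding cycle_space_def by blast
    ultimately show ?thesis using out by (auto simp: fun_eq_iff)
  qed
  have "\<exists>z\<in>cycle_space. \<forall>e'\<in>E. z e' = (if e' = e then 1 else 0)" if e: "e \<in> E" for e
  proof -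
    have eG: "e \<in> arcs G" "e \<notin> F" "arev e \<notin> E" using e E by blast+
    have ne: "arev e \<noteq> e" using arev_neq[OF eG(1)] .
    \<comment> \<open>The single edge \<open>e\<close> as a chain. Its boundary has total 0, so a
      flow \<open>h\<close> on the tree cancels it.\<close>
    define f0 :: "'b \<Rightarrow> rat" where "f0 d = (if d = e then 1 else if d = arev e then - 1 else 0)" for d
    have f0_rev: "f0 (arev d) = - f0 d" for d
      using ne arev_eq_iff[of d e] arev_eq_iff[of d "arev e"] unfolding f0_def by auto
    have f0_F: "f0 d = 0" if "d \<in> F" for d using that eG rF unfolding f0_def by auto
    have "(\<Sum>v\<in>verts G. - (\<Sum>d\<in>out_arcs G v. f0 d)) = - (\<Sum>d\<in>arcs G. f0 d)"
    proof -
      have U: "arcs G = (\<Union>v\<in>verts G. out_arcs G v)" by auto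
      have "(\<Sum>d\<in>(\<Union>v\<in>verts G. out_arcs G v). f0 d) = (\<Sum>v\<in>verts G. \<Sum>d\<in>out_arcs G v. f0 d)"
        using fin F(2) by (intro sum.UNION_disjoint) (auto simp: out_arcs_Collect)
      then have "(\<Sum>d\<in>arcs G. f0 d) = (\<Sum>v\<in>verts G. \<Sum>d\<in>out_arcs G v. f0 d)" by (subst U)
      then show ?thesis by (simp only: sum_negf)
    qed
    also have "\<dots> = 0" using antisymmetric_sum[of "arcs G" f0] f0_rev by simp
    finally obtain h where h: "\<forall>d. d \<notin> F \<longrightarrow> h d = 0" "\<forall>d\<in>F. h (arev d) = - h d"
      "\<forall>v\<in>verts G. (\<Sum>d | d \<in> F \<and> tail G d = v. h d) = - (\<Sum>d\<in>out_arcs G v. f0 d)"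
      using grown_flow_exists[OF g] by blast
    have "(\<Sum>d\<in>out_arcs G v. f0 d + h d) = 0" if "v \<in> verts G" for v
    proof -
      have "(\<Sum>d\<in>out_arcs G v. h d) = (\<Sum>d | d \<in> F \<and> tail G d = v. h d)"
        unfolding split using h(1) by (simp add: sum.neutral)
      then show ?thesis using h(3) that by (simp add: sum.distrib)
    qed
    moreover have "f0 (arev d) + h (arev d) = - (f0 d + h d)" for d
      using f0_rev[of d] h(1,2) rF[of d] by (cases "d \<in> F") simp_all
    moreover have "f0 d + h d = 0" if "d \<notin> arcs G" for d
      using that h(1) F(1) eG arev_in_arcs[OF eG(1)] unfolding f0_def by auto
    ultimately have "(\<lambda>d. f0 d + h d) \<in> cycle_space" unfolding cycle_space_def by blast
    moreover have "f0 d + h d = (if d = e then 1 else 0)" if "d \<in> E" for d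
      using that h(1) E(1) eG unfolding f0_def by auto
    ultimately show ?thesis by (intro bexI[of _ "\<lambda>d. f0 d + h d"]) simp_all
  qed
  then obtain z where z: "\<And>e. e \<in> E \<Longrightarrow> z e \<in> cycle_space"
    "\<And>e e'. e \<in> E \<Longrightarrow> e' \<in> E \<Longrightarrow> z e e' = (if e' = e then 1 else 0)"
    by metis
  have inj: "inj_on z E"
    using z(2) by (intro inj_onI) (metis zero_neq_one)
  have coord: "(\<Sum>e\<in>E. c e * z e e') = c e'" if "e' \<in> E" for c e'
  proof -
    have "(\<Sum>e\<in>E. c e * z e e') = (\<Sum>e\<in>E. if e = e' then c e else 0)"
      using z(2) that by (intro sum.cong) auto
    then show ?thesis using finE that by simp
  qed
  have sum_apply: "(\<Sum>x\<in>A. h x) e = (\<Sum>x\<in>A. h x e)" for A :: "'c set" and h :: "'c \<Rightarrow> 'b \<Rightarrow> rat" and e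
    by (induction A rule: infinite_finite_induct) auto
  have "vs.independent (z ` E)"
  proof (rule vs.independent_if_scalars_zero)
    fix c x assume 0: "(\<Sum>x\<in>z ` E. (\<lambda>e. c x * x e)) = 0" and "x \<in> z ` E"
    then obtain e' where e': "e' \<in> E" "x = z e'" by blast
    have "(\<Sum>e\<in>E. c (z e) * z e e') = (\<Sum>x\<in>z ` E. (\<lambda>e. c x * x e)) e'"
      by (simp add: sum_apply sum.reindex[OF inj])
    then show "c x = 0" using coord[OF e'(1)] 0 e'(2) by simp
  qed (use finE in simp)
  moreover have "cycle_space \<subseteq> vs.span (z ` E)"
  proof
    fix f assume f: "f \<in> cycle_space"
    \<comment> \<open>The combination of fundamental cycles with the same values as \<open>f\<close>
      on \<open>E\<close>; the difference is a cycle vanishing on \<open>E\<close>, hence 0.\<close>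
    define s where "s = (\<Sum>e\<in>E. (\<lambda>d. f e * z e d))"
    have s: "s d = (\<Sum>e\<in>E. f e * z e d)" for d unfolding s_def by (simp add: sum_apply)
    have zc: "e \<in> E \<Longrightarrow> d \<notin> arcs G \<Longrightarrow> z e d = 0" "e \<in> E \<Longrightarrow> d \<in> arcs G \<Longrightarrow> z e (arev d) = - z e d"
      "e \<in> E \<Longrightarrow> v \<in> verts G \<Longrightarrow> (\<Sum>d\<in>out_arcs G v. z e d) = 0" for e d v
      using z(1) unfolding cycle_space_def by blast+
    have "(\<Sum>d\<in>out_arcs G v. s d) = 0" if "v \<in> verts G" for v
      unfolding s using zc(3) that by (subst sum.swap) (simp flip: sum_distrib_left)
    moreover have "s (arev d) = - s d" if "d \<in> arcs G" for d
      unfolding s using zc(2) that by (simp add: sum_negf)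
    moreover have "s d = 0" if "d \<notin> arcs G" for d unfolding s using zc(1) that by simp
    ultimately have "f - s \<in> cycle_space" using f unfolding cycle_space_def by (simp add: sum_subtractf)
    moreover have "(f - s) e = 0" if "e \<in> E" for e using coord[OF that] by (simp add: s)
    ultimately have "f - s = 0" using cyc_eq0 by blast
    then have "f = s" by simp
    moreover have "s \<in> vs.span (z ` E)"
      unfolding s_def by (intro vs.span_sum vs.span_scale vs.span_base imageI)
    ultimately show "f \<in> vs.span (z ` E)" by simp
  qed
  moreover have "z ` E \<subseteq> cycle_space" using z(1) by blast
  moreover have "card (z ` E) = card E" by (rule card_image[OF inj])
  ultimately show ?thesis unfolding first_betti_number_def by (intro vs.dim_unique[of "z ` E"])
qed

lemma card_orientation:
  assumes fin: "finite A" and A: "\<And>e. e \<in> A \<Longrightarrow> arev e \<in> A"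
    and E: "E \<subseteq> A" "\<And>e. e \<in> A \<Longrightarrow> (e \<in> E) \<noteq> (arev e \<in> E)"
  shows "card A = 2 * card E"
proof -
  have "A = E \<union> arev ` E"
  proof
    show "A \<subseteq> E \<union> arev ` E" using E(2) by (metis UnI1 UnI2 arev_arev imageI subsetI)
  qed (use E(1) A in blast)
  moreover have "E \<inter> arev ` E = {}" using E by (auto dest: E(2)[OF subsetD[OF E(1)]])
  moreover have "card (arev ` E) = card E" by (rule card_image) (rule inj_on_arev)
  ultimately show ?thesis using fin by (metis card_Un_disjoint finite_Un mult_2)
qed

end

section \<open>Generating sets as presentations\<close>

lemma (in bidirected_digraph) grown_constant:
  "grown W F \<Longrightarrow> (\<And>e. e \<in> F \<Longrightarrow> h (head G e) = h (tail G e)) \<Longrightarrow> u \<in> W \<Longrightarrow> v \<in> W \<Longrightarrow> h u = h v"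
proof (induction arbitrary: u v rule: grown.induct)
  case (leaf W F e)
  have "h w = h (tail G e)" if "w \<in> insert (head G e) W" for w
    using that leaf.IH[of w "tail G e"] leaf.prems(1) leaf.hyps(3) by auto
  then show ?case using leaf.prems(2,3) by simp
qed simp

lemma card_Un3_le: "card (X \<union> Y \<union> Z) \<le> card X + card Y + card Z"
  using card_Un_le[of "X \<union> Y" Z] card_Un_le[of X Y] by linarith

section \<open>Words acting on models, and the presentation read off a generating set\<close>

context labelled_graph begin

fun letter_act :: "('v \<Rightarrow> int \<Rightarrow> nat \<Rightarrow> nat) \<Rightarrow> ('e \<Rightarrow> nat \<Rightarrow> nat) \<Rightarrow> ('v, 'e, int) letter \<Rightarrow> nat \<Rightarrow> nat" where
  "letter_act al ta (Elt v k) = al v k"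
| "letter_act al ta (Edge e) = ta e"

definition word_act :: "('v \<Rightarrow> int \<Rightarrow> nat \<Rightarrow> nat) \<Rightarrow> ('e \<Rightarrow> nat \<Rightarrow> nat) \<Rightarrow> ('v, 'e, int) letter list \<Rightarrow> nat \<Rightarrow> nat" where
  "word_act al ta w = foldr (letter_act al ta) w"

lemma word_act_simps [simp]:
  "word_act al ta [] z = z"
  "word_act al ta (l # w) z = letter_act al ta l (word_act al ta w z)"
  "word_act al ta (w @ w') z = word_act al ta w (word_act al ta w' z)"
  by (simp_all add: word_act_def)

lemma word_act_word_eq:
  assumes m: "gmodel al ta" and T: "\<And>e x. e \<in> arcs T \<Longrightarrow> ta e x = x"
  shows "word_eq T w w' \<Longrightarrow> word_act al ta w z = word_act al ta w' z"
proof (induction arbitrary: z rule: word_eq.induct)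
  case (elt_mult v g h)
  then show ?case using zaction_add[OF gmodelD(1)[OF m]] by simp
next
  case (elt_one v)
  then show ?case using gmodelD(1)[OF m] by simp
next
  case (edge_inv e)
  then show ?case using gmodelD(2)[OF m, of "arev e"] by simp
next
  case (edge_conj e c)
  then show ?case using gmodelD(3)[OF m, of e c] gmodelD(2)[OF m, of "arev e"] by simp
qed (simp_all add: T)

text \<open>The elements fixing \<open>z\<close> form a subgroup. As the action is defined on words,
  membership is expressed by a representing word that fixes \<open>z\<close>.\<close>

lemma generators_fix_all:
  assumes m: "gmodel al ta" and T: "\<And>e x. e \<in> arcs T \<Longrightarrow> ta e x = x"
    and gen: "generate (fundamental_group T) S = carrier (fundamental_group T)"
    and S: "\<And>C. C \<in> S \<Longrightarrow> \<exists>w\<in>gwords. C = word_class T w \<and> word_act al ta w z = z"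
    and w: "w \<in> gwords"
  shows "word_act al ta w z = z"
proof -
  interpret F: group "fundamental_group T" by (rule group_fundamental_group)
  have eq: "word_act al ta u x = word_act al ta u' x" if "word_eq T u u'" for u u' x
    by (rule word_act_word_eq[OF m _ that]) (rule T)
  have "\<exists>w\<in>gwords. C = word_class T w \<and> word_act al ta w z = z" if "C \<in> generate (fundamental_group T) S" for C
    using that
  proof (induction rule: generate.induct)
    case one
    show ?case by (rule bexI[of _ "[]"]) (simp_all add: one_fundamental_group gwords_def)
  next
    case (incl C)
    then show ?case by (rule S)
  next
    case (inv C)
    then obtain w where w: "w \<in> gwords" "C = word_class T w" "word_act al ta w z = z" using S by blast
    obtain u where u: "u \<in> gwords" "word_eq T (u @ w) []" using left_inverse_word[OF w(1)] by blast
    have "word_class T u \<otimes>\<^bsub>fundamental_group T\<^esub> C = \<one>\<^bsub>fundamental_group T\<^esub>"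
      using u(2) w(2) by (simp add: mult_word_class one_fundamental_group word_class_eq_iff)
    then have "inv\<^bsub>fundamental_group T\<^esub> C = word_class T u"
      using u(1) w(1,2) by (intro F.inv_equality) (auto simp: carrier_fundamental_group)
    moreover have "word_act al ta u z = z" using eq[OF u(2), of z] w(3) by simp
    ultimately show ?case using u(1) by blast
  next
    case (eng C C')
    then obtain w w' where "w \<in> gwords" "C = word_class T w" "word_act al ta w z = z"
      "w' \<in> gwords" "C' = word_class T w'" "word_act al ta w' z = z" by blast
    then show ?case by (intro bexI[of _ "w @ w'"]) (auto simp: mult_word_class gwords_def)
  qed
  moreover have "word_class T w \<in> generate (fundamental_group T) S"
    using gen w by (simp add: carrier_fundamental_group)
  ultimately obtain w' where "word_class T w = word_class T w'" "word_act al ta w' z = z" by blast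
  then show ?thesis using eq[of w w' z] word_class_eq_iff[of T w w'] by simp
qed

text \<open>Transport of structure along \<open>c\<close>. With \<open>c\<close> from
  \<open>grown_potential\<close> the tree edges become identities, as needed for words to act
  through the fundamental group.\<close>

lemma gmodel_untwist:
  assumes m: "gmodel al ta" and cd: "\<And>v x. c v (d v x) = x" "\<And>v x. d v (c v x) = x"
  shows "gmodel (\<lambda>v k x. c v (al v k (d v x))) (\<lambda>e x. c (head G e) (ta e (d (tail G e) x)))"
  unfolding gmodel_def
proof (intro conjI allI ballI)
  fix v show "zaction (\<lambda>k x. c v (al v k (d v x)))"
    using gmodelD(1)[OF m, of v] cd unfolding zaction_def by simp
next
  fix e x assume "e \<in> arcs G"
  then show "c (head G (arev e)) (ta (arev e) (d (tail G (arev e)) (c (head G e) (ta e (d (tail G e) x))))) = x"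
    using gmodelD(2)[OF m, of e] cd by simp
next
  fix e k x assume "e \<in> arcs G"
  then show "c (head G e) (ta e (d (tail G e) (c (tail G e) (al (tail G e) (lab e * k) (d (tail G e) x)))))
    = c (head G e) (al (head G e) (lab (arev e) * k) (d (head G e) (c (head G e) (ta e (d (tail G e) x)))))"
    using gmodelD(3)[OF m, of e k] cd by simp
qed

text \<open>
  The point \<open>(i, j, v)\<close> is the \<open>v\<close>-copy of the position \<open>j\<close> in the word for the \<open>i\<close>-th generator, and
  \<open>(n, 0)\<close> is the base point; the copies of one position are joined by the tree edges. Words act from
  the left, so the path of a word starts at its last position.
\<close>

lemma generating_set_lower_bound:
  assumes g: "grown (verts G) (arcs T)"
    and S: "finite S" "S \<subseteq> carrier (fundamental_group T)"
      "generate (fundamental_group T) S = carrier (fundamental_group T)"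
  shows "card (arcs G) + 2 * plateaunic_number + 2 \<le> 2 * card S + 2 * card (verts G)"
proof -
  define n where "n = card S"
  obtain s where s: "bij_betw s {..<n} S"
    using S(1) unfolding n_def by (metis ex_bij_betw_nat_finite lessThan_atLeast0)
  have "\<forall>i. \<exists>w. i < n \<longrightarrow> w \<in> gwords \<and> s i = word_class T w"
    using s S(2) bij_betwE unfolding carrier_fundamental_group by fastforce
  from choice[OF this] obtain w where w: "\<And>i. i < n \<Longrightarrow> w i \<in> gwords" "\<And>i. i < n \<Longrightarrow> s i = word_class T (w i)"
    by blast
  obtain v0 where v0: "v0 \<in> verts G" using g by (cases rule: grown.cases) auto
  have TG: "arcs T \<subseteq> arcs G" "\<And>e. e \<in> arcs T \<Longrightarrow> arev e \<in> arcs T"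
    using grown_subset[OF g] grown_arcs[OF g] by blast+
  define L where "L = (SIGMA i:{..<n}. {..<length (w i)})"
  \<comment> \<open>A word has one position more than letters. Words are numbered below
    \<open>n\<close>, so the base point \<open>(n, 0)\<close> differs from all their
    positions.\<close>
  define Pos where "Pos = insert (n, 0) (L \<union> (\<lambda>i. (i, length (w i))) ` {..<n})"
  have "finite L" unfolding L_def by simp
  have "card ((\<lambda>i. (i, length (w i))) ` {..<n}) = n" by (subst card_image) (auto intro: inj_onI)
  moreover have "L \<inter> (\<lambda>i. (i, length (w i))) ` {..<n} = {}" unfolding L_def by auto
  ultimately have "card (L \<union> (\<lambda>i. (i, length (w i))) ` {..<n}) = card L + n"
    using \<open>finite L\<close> by (simp add: card_Un_disjoint)
  moreover have "(n, 0) \<notin> L \<union> (\<lambda>i. (i, length (w i))) ` {..<n}" unfolding L_def by auto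
  ultimately have cardPos: "card Pos = card L + n + 1" and "finite Pos"
    unfolding Pos_def using \<open>finite L\<close> by simp_all
  have Pos: "(i, j) \<in> Pos" if "i < n" "j \<le> length (w i)" for i j
    using that unfolding Pos_def L_def by (cases "j < length (w i)") auto
  define P :: "(nat \<times> nat \<times> 'v) set" where "P = {(i, j, v). (i, j) \<in> Pos \<and> v \<in> verts G}"
  define ty :: "nat \<times> nat \<times> 'v \<Rightarrow> 'v" where "ty = snd \<circ> snd"
  have ty: "ty (i, j, v) = v" for i j v by (simp add: ty_def)
  have "P = (\<lambda>((i, j), v). (i, j, v)) ` (Pos \<times> verts G)" unfolding P_def by force
  moreover have "inj_on (\<lambda>((i, j), v). (i, j, v)) (Pos \<times> verts G)" by (auto intro: inj_onI)
  ultimately have cardP: "card P = card Pos * card (verts G)" and "finite P"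
    using \<open>finite Pos\<close> by (simp_all add: card_image card_cartesian_product)
  define LE where "LE = {(i, j) \<in> L. \<exists>v k. w i ! j = Elt v k}"
  define LA where "LA = {(i, j) \<in> L. \<exists>e. w i ! j = Edge e}"
  have "L = LE \<union> LA" unfolding LE_def LA_def by (auto, metis letter.exhaust)
  moreover have "LE \<inter> LA = {}" unfolding LE_def LA_def by auto
  ultimately have cardL: "card L = card LE + card LA" and finL: "finite LE" "finite LA"
    using \<open>finite L\<close> by (auto simp: card_Un_disjoint)
  \<comment> \<open>\<open>tie\<close> is unspecified at edge letters, and \<open>edge\<close> and
    \<open>edge'\<close> at vertex letters; they are applied only on \<open>LE\<close> and
    \<open>LA\<close>. The letter at \<open>j\<close> leads from position \<open>Suc j\<close> to
    position \<open>j\<close>.\<close>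
  define tie where "tie = (\<lambda>(i, j). case w i ! j of Elt v k \<Rightarrow> ((i, Suc j, v), k, (i, j, v)))"
  define edge where "edge = (\<lambda>(i, j). case w i ! j of Edge e \<Rightarrow> ((i, Suc j, tail G e), e, (i, j, head G e)))"
  define edge' where "edge' = (\<lambda>(i, j). case w i ! j of Edge e \<Rightarrow> ((i, j, head G e), arev e, (i, Suc j, tail G e)))"
  \<comment> \<open>Exponent 0 means identification. One copy, that of \<open>v0\<close>, suffices,
    because the tree edges bind the copies of a position together.\<close>
  define start :: "nat \<Rightarrow> (nat \<times> nat \<times> 'v) \<times> int \<times> (nat \<times> nat \<times> 'v)"
    where "start i = ((n, 0, v0), 0, (i, length (w i), v0))" for i
  define stop :: "nat \<Rightarrow> (nat \<times> nat \<times> 'v) \<times> int \<times> (nat \<times> nat \<times> 'v)"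
    where "stop i = ((i, 0, v0), 0, (n, 0, v0))" for i
  define A where "A = tie ` LE \<union> start ` {..<n} \<union> stop ` {..<n}"
  define tr where "tr = (\<lambda>((i :: nat, j :: nat), e). ((i, j, tail G e), e, (i, j, head G e)))"
  define B where "B = tr ` (Pos \<times> arcs T) \<union> edge ` LA \<union> edge' ` LA"
  have finT: "finite (arcs T)" using grown_finite[OF g] by blast
  have LE_letter: "i < n \<and> Suc j \<le> length (w i) \<and> v \<in> verts G"
    if "(i, j) \<in> L" "w i ! j = Elt v k" for i j v k
    using that w(1)[of i] nth_mem[of j "w i"] unfolding L_def gwords_def by fastforce
  have LA_letter: "i < n \<and> Suc j \<le> length (w i) \<and> e \<in> arcs G"
    if "(i, j) \<in> L" "w i ! j = Edge e" for i j e
    using that w(1)[of i] nth_mem[of j "w i"] unfolding L_def gwords_def by fastforce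
  have "card A \<le> card (tie ` LE) + card (start ` {..<n}) + card (stop ` {..<n})"
    unfolding A_def by (rule card_Un3_le)
  also have "\<dots> \<le> card LE + card {..<n} + card {..<n}"
    by (intro add_mono card_image_le finL finite_lessThan)
  finally have cardA: "card A \<le> card LE + n + n" by simp
  have "card B \<le> card (tr ` (Pos \<times> arcs T)) + card (edge ` LA) + card (edge' ` LA)"
    unfolding B_def by (rule card_Un3_le)
  also have "\<dots> \<le> card (Pos \<times> arcs T) + card LA + card LA"
    by (intro add_mono card_image_le finL finite_cartesian_product \<open>finite Pos\<close> finT)
  finally have cardB: "card B \<le> card Pos * card (arcs T) + card LA + card LA"
    by (simp add: card_cartesian_product)
  have p: "presentation ty P A B"
    unfolding presentation_def
  proof (intro conjI)
    show "finite P" by fact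
    show "finite A" "finite B" unfolding A_def B_def using finL finT \<open>finite Pos\<close> by auto
    show "ty ` P = verts G"
    proof
      show "verts G \<subseteq> ty ` P"
      proof
        fix v assume "v \<in> verts G"
        then have "(n, 0, v) \<in> P" unfolding P_def Pos_def by simp
        then show "v \<in> ty ` P" using ty by (metis imageI)
      qed
    qed (auto simp: P_def ty)
    show "\<forall>(x, k, y)\<in>A. x \<in> P \<and> y \<in> P \<and> ty x = ty y"
    proof
      fix t assume "t \<in> A"
      then consider (tie) i j where "(i, j) \<in> LE" "t = tie (i, j)" | (start) i where "i < n" "t = start i"
        | (stop) i where "i < n" "t = stop i"
        unfolding A_def by force
      then show "case t of (x, k, y) \<Rightarrow> x \<in> P \<and> y \<in> P \<and> ty x = ty y"
      proof cases
        case tie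
        then obtain v k where "(i, j) \<in> L" "w i ! j = Elt v k" unfolding LE_def by blast
        then show ?thesis
          using tie(2) LE_letter[of i j v k] Pos[of i "Suc j"] Pos[of i j] by (simp add: tie_def P_def ty)
      next
        case start
        then show ?thesis using Pos[of i "length (w i)"] v0 by (simp add: start_def P_def ty Pos_def)
      next
        case stop
        then show ?thesis using Pos[of i 0] v0 by (simp add: stop_def P_def ty Pos_def)
      qed
    qed
    show "\<forall>(x, e, y)\<in>B. x \<in> P \<and> y \<in> P \<and> e \<in> arcs G \<and> ty x = tail G e \<and> ty y = head G e \<and> (y, arev e, x) \<in> B"
    proof (clarify, goal_cases)
      case (1 x1 x2 x3 e y1 y2 y3)
      then consider (tree) i j where "(i, j) \<in> Pos" "e \<in> arcs T" "x1 = i" "x2 = j" "x3 = tail G e" "y1 = i" "y2 = j" "y3 = head G e"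
        | (edge) i j where "(i, j) \<in> L" "w i ! j = Edge e" "x1 = i" "x2 = Suc j" "x3 = tail G e" "y1 = i" "y2 = j" "y3 = head G e"
        | (edge') i j f where "(i, j) \<in> L" "w i ! j = Edge f" "e = arev f" "x1 = i" "x2 = j" "x3 = head G f" "y1 = i" "y2 = Suc j" "y3 = tail G f"
        unfolding B_def tr_def edge_def edge'_def LA_def by auto
      then show ?case
      proof cases
        case tree
        have "((i, j), arev e) \<in> Pos \<times> arcs T" using tree TG by simp
        then have "tr ((i, j), arev e) \<in> B" unfolding B_def by blast
        then show ?thesis using tree TG unfolding P_def by (auto simp: ty tr_def)
      next
        case edge
        have "(i, j) \<in> LA" using edge unfolding LA_def by blast
        then have "edge' (i, j) \<in> B" unfolding B_def by blast
        then show ?thesis using edge LA_letter[OF edge(1,2)] Pos[of i "Suc j"] Pos[of i j]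
          unfolding P_def by (auto simp: ty edge'_def)
      next
        case edge'
        have "(i, j) \<in> LA" using edge' unfolding LA_def by blast
        then have "edge (i, j) \<in> B" unfolding B_def by blast
        then show ?thesis using edge' LA_letter[OF edge'(1,2)] Pos[of i "Suc j"] Pos[of i j]
          unfolding P_def by (auto simp: ty edge_def)
      qed
    qed
  qed
  have t: "terminal ty P A B"
    unfolding terminal_def
  proof (intro allI impI)
    fix al ta f assume m: "gmodel al ta" and sat: "satisfies al ta ty A B f"
    have satA: "al (ty x) k (f x) = f y" if "(x, k, y) \<in> A" for x k y
      using sat that unfolding satisfies_def by blast
    have satB: "ta e (f x) = f y" if "(x, e, y) \<in> B" for x e y
      using sat that unfolding satisfies_def by blast
    obtain c d :: "'v \<Rightarrow> nat \<Rightarrow> nat" where cd: "\<And>v x. c v (d v x) = x" "\<And>v x. d v (c v x) = x"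
      and cT: "\<And>e x. e \<in> arcs T \<Longrightarrow> c (head G e) (ta e x) = c (tail G e) x"
      using grown_potential[of ta "verts G" "arcs T", OF gmodelD(2)[OF m] g] by blast
    define al' where "al' v k x = c v (al v k (d v x))" for v k x
    define ta' where "ta' e x = c (head G e) (ta e (d (tail G e) x))" for e x
    have m': "gmodel al' ta'"
      using gmodel_untwist[OF m cd] unfolding al'_def[abs_def] ta'_def[abs_def] .
    have T': "ta' e x = x" if "e \<in> arcs T" for e x using cT[OF that] cd by (simp add: ta'_def)
    \<comment> \<open>The untwisted value of a position, which no longer depends on the copy by
      \<open>H\<close> below.\<close>
    define H where "H i j = c v0 (f (i, j, v0))" for i j
    have H: "c v (f (i, j, v)) = H i j" if "(i, j) \<in> Pos" "v \<in> verts G" for i j v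
      unfolding H_def
    proof (rule grown_constant[OF g _ that(2) v0, of "\<lambda>v. c v (f (i, j, v))"])
      fix e assume e: "e \<in> arcs T"
      then have "tr ((i, j), e) \<in> B" unfolding B_def using that(1) by blast
      then have "ta e (f (i, j, tail G e)) = f (i, j, head G e)" unfolding tr_def by (simp add: satB)
      then show "c (head G e) (f (i, j, head G e)) = c (tail G e) (f (i, j, tail G e))"
        using cT[OF e] by metis
    qed
    have lstep: "H i j = letter_act al' ta' (w i ! j) (H i (Suc j))" if ij: "(i, j) \<in> L" for i j
    proof (cases "w i ! j")
      case (Elt v k)
      note l = LE_letter[OF ij Elt]
      have "(i, j) \<in> LE" using ij Elt unfolding LE_def by blast
      then have "tie (i, j) \<in> A" unfolding A_def by blast
      then have "al v k (f (i, Suc j, v)) = f (i, j, v)"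
        using satA[of "(i, Suc j, v)" k "(i, j, v)"] Elt by (simp add: tie_def ty)
      moreover have "c v (f (i, j, v)) = H i j" "c v (f (i, Suc j, v)) = H i (Suc j)"
        using H Pos l by simp_all
      then have "f (i, Suc j, v) = d v (H i (Suc j))" using cd(2) by metis
      ultimately show ?thesis using \<open>c v (f (i, j, v)) = H i j\<close> Elt by (simp add: al'_def)
    next
      case (Edge e)
      note l = LA_letter[OF ij Edge]
      have "(i, j) \<in> LA" using ij Edge unfolding LA_def by blast
      then have "edge (i, j) \<in> B" unfolding B_def by blast
      then have "ta e (f (i, Suc j, tail G e)) = f (i, j, head G e)"
        using satB[of "(i, Suc j, tail G e)" e "(i, j, head G e)"] Edge by (simp add: edge_def)
      moreover have "c (head G e) (f (i, j, head G e)) = H i j"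
        "c (tail G e) (f (i, Suc j, tail G e)) = H i (Suc j)"
        using H Pos l by simp_all
      then have "f (i, Suc j, tail G e) = d (tail G e) (H i (Suc j))" using cd(2) by metis
      ultimately show ?thesis
        using \<open>c (head G e) (f (i, j, head G e)) = H i j\<close> Edge by (simp add: ta'_def)
    qed
    have path: "H i j = word_act al' ta' (drop j (w i)) (H i (length (w i)))"
      if "i < n" "j \<le> length (w i)" for i j
      using that(2)
    proof (induction rule: inc_induct)
      case (step j)
      have "(i, j) \<in> L" using step.hyps that(1) unfolding L_def by simp
      then show ?case using \<open>j < length (w i)\<close> step.IH lstep[of i j]
        by (simp add: Cons_nth_drop_Suc[symmetric])
    qed simp
    define z where "z = H n 0"
    have ends: "H i (length (w i)) = z \<and> H i 0 = z" if "i < n" for i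
    proof -
      have "((n, 0, v0), 0, (i, length (w i), v0)) \<in> A" "((i, 0, v0), 0, (n, 0, v0)) \<in> A"
        using that unfolding A_def start_def stop_def by auto
      from this[THEN satA] show ?thesis using gmodelD(1)[OF m] unfolding z_def H_def by (simp add: ty)
    qed
    have fix_S: "\<exists>u\<in>gwords. C = word_class T u \<and> word_act al' ta' u z = z" if "C \<in> S" for C
    proof -
      have "C \<in> s ` {..<n}" using s that by (simp add: bij_betw_def)
      then obtain i where i: "i < n" "C = s i" by blast
      have "word_act al' ta' (w i) z = z" using path[OF i(1), of 0] ends[OF i(1)] by simp
      then show ?thesis using i w by blast
    qed
    have fix_all: "word_act al' ta' u z = z" if "u \<in> gwords" for u
      by (rule generators_fix_all[OF m' _ S(3) _ that]) (use T' fix_S in blast)+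
    have "H i j = z" if ij: "(i, j) \<in> Pos" for i j
    proof (cases "i < n")
      case True
      then have "j \<le> length (w i)" using ij unfolding Pos_def L_def by auto
      \<comment> \<open>The word fixes \<open>z\<close>, but its suffixes only do so because
        \<open>S\<close> generates: by \<open>fix_all\<close>, every word fixes
        \<open>z\<close>.\<close>
      moreover have "drop j (w i) \<in> gwords" using w(1)[OF True] unfolding gwords_def by (auto dest: in_set_dropD)
      ultimately show ?thesis using path[OF True] ends[OF True] fix_all by simp
    next
      case False
      then show ?thesis using ij unfolding Pos_def L_def z_def by auto
    qed
    then have "f (i, j, v) = d v z" if "(i, j) \<in> Pos" "v \<in> verts G" for i j v
      using H[OF that] that(1) cd(2)[of v "f (i, j, v)"] by simp
    then have f: "f x = d (ty x) z" if "x \<in> P" for x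
      using that unfolding P_def by (auto simp: ty)
    have tyP: "ty x \<in> verts G" if "x \<in> P" for x using that unfolding P_def by (auto simp: ty)
    have "al v k (d v z) = d v z" if "v \<in> verts G" for v k
    proof -
      have "c v (al v k (d v z)) = z" using fix_all[of "[Elt v k]"] that by (simp add: gwords_def al'_def)
      then show ?thesis using cd(2)[of v "al v k (d v z)"] by simp
    qed
    moreover have "ta e (d (tail G e) z) = d (head G e) z" if "e \<in> arcs G" for e
    proof -
      have "c (head G e) (ta e (d (tail G e) z)) = z"
        using fix_all[of "[Edge e]"] that by (simp add: gwords_def ta'_def)
      then show ?thesis using cd(2)[of "head G e" "ta e (d (tail G e) z)"] by simp
    qed
    ultimately show "(\<forall>x\<in>P. \<forall>k. al (ty x) k (f x) = f x)
      \<and> (\<forall>x\<in>P. \<forall>y\<in>P. ty x = ty y \<longrightarrow> f x = f y)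
      \<and> (\<forall>e\<in>arcs G. \<forall>x\<in>P. \<forall>y\<in>P. ty x = tail G e \<longrightarrow> ty y = head G e \<longrightarrow> ta e (f x) = f y)"
      using f tyP by simp
  qed
  \<comment> \<open>The products are abbreviated to make the final inequality linear. With
    \<open>r + 2 * card Pos = 2 * q\<close>, all copies cancel and the excess is that of the word
    graph, \<open>n - 1\<close>.\<close>
  define q where "q = card Pos * card (verts G)"
  define r where "r = card Pos * card (arcs T)"
  have "r + 2 * card Pos = 2 * q"
    using arg_cong[OF grown_card[OF g], of "\<lambda>m. card Pos * m"] unfolding q_def r_def
    by (simp add: distrib_left)
  then show ?thesis
    using presentation_bound[OF p t] cardA cardB cardPos cardL
    unfolding cardP q_def[symmetric] r_def[symmetric] n_def by linarith
qed

end

section \<open>The rank\<close>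

context labelled_graph begin

text \<open>Keep the arcs at \<open>W\<close> with label prime to \<open>p\<close>. By
  \<open>closed\<close> they form a graph on \<open>W\<close> stable under reversal, and the
  component of \<open>v\<close> in it is a \<open>p\<close>-plateau.\<close>

lemma plateau_within:
  assumes W: "W \<subseteq> verts G" "v \<in> W"
    and closed: "\<And>e. e \<in> arcs G \<Longrightarrow> tail G e \<in> W \<Longrightarrow> \<not> int p dvd lab e \<Longrightarrow>
      head G e \<in> W \<and> \<not> int p dvd lab (arev e)"
  shows "\<exists>P. p_plateau p P \<and> verts P \<subseteq> W"
proof -
  define R where "R = {e \<in> arcs G. tail G e \<in> W \<and> \<not> int p dvd lab e}"
  have R: "e \<in> arcs G \<and> head G e \<in> W \<and> arev e \<in> R" if "e \<in> R" for e
    using that closed[of e] unfolding R_def by simp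
  define S where "S = (\<lambda>e. (tail G e, head G e)) ` R"
  have "sym S"
  proof (rule symI)
    fix x y assume "(x, y) \<in> S"
    then obtain e where e: "e \<in> R" "x = tail G e" "y = head G e" unfolding S_def by blast
    show "(y, x) \<in> S"
      unfolding S_def by (rule image_eqI[of _ _ "arev e"]) (use e R[OF e(1)] in simp_all)
  qed
  define C where "C = {u. (v, u) \<in> S\<^sup>*}"
  have CW: "C \<subseteq> W"
  proof
    fix u assume "u \<in> C"
    then have "(v, u) \<in> S\<^sup>*" unfolding C_def by simp
    then show "u \<in> W"
    proof (induction rule: rtrancl_induct)
      case (step y z)
      then show ?case using R unfolding S_def by fast
    qed (rule W(2))
  qed
  define F where "F = {e \<in> R. tail G e \<in> C}"
  have head_C: "head G e \<in> C" if "e \<in> R" "tail G e \<in> C" for e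
  proof -
    have "(tail G e, head G e) \<in> S" using that(1) unfolding S_def by blast
    then show ?thesis using that(2) unfolding C_def by (simp add: rtrancl_into_rtrancl)
  qed
  have walk: "\<exists>q. set q \<subseteq> F \<and> cas x q y" if "(x, y) \<in> S\<^sup>*" "x \<in> C" for x y
    using that
  proof (induction rule: converse_rtrancl_induct)
    case base
    show ?case by (intro exI[of _ "[]"]) simp
  next
    case (step x z)
    then obtain e where e: "e \<in> R" "x = tail G e" "z = head G e" unfolding S_def by blast
    then have "e \<in> F" "z \<in> C" using step.prems head_C unfolding F_def by simp_all
    then obtain q where "set q \<subseteq> F" "cas z q y" using step.IH by blast
    then show ?case using e \<open>e \<in> F\<close> by (intro exI[of _ "e # q"]) simp
  qed
  have ss: "serre_subgraph (part C F)"
  proof (rule part_serre_subgraph)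
    fix e assume "e \<in> F"
    then show "tail G e \<in> C \<and> head G e \<in> C \<and> arev e \<in> F"
      using head_C[of e] R[of e] unfolding F_def by simp
  qed (use CW W R in \<open>auto simp: F_def\<close>)
  moreover have vC: "v \<in> C" unfolding C_def by simp
  moreover have "Digraph_Component.connected (part C F)"
  proof (rule part_connected[OF ss])
    fix x y assume "x \<in> C" "y \<in> C"
    then have "(v, x) \<in> S\<^sup>*" "(v, y) \<in> S\<^sup>*" unfolding C_def by simp_all
    then have "(x, y) \<in> S\<^sup>*" using sym_rtrancl[OF \<open>sym S\<close>] by (meson symD rtrancl_trans)
    then show "\<exists>q. set q \<subseteq> F \<and> cas x q y" using walk \<open>x \<in> C\<close> by blast
  qed (use vC in blast)
  moreover have "int p dvd lab e \<longleftrightarrow> e \<notin> F" if "e \<in> arcs G" "tail G e \<in> C" for e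
    using that CW unfolding F_def R_def by blast
  ultimately have "p_plateau p (part C F)" unfolding p_plateau_def by auto
  then show ?thesis using CW by (intro exI[of _ "part C F"]) simp
qed

text \<open>For a prime larger than all labels no label is divisible, so
  \<open>plateau_within\<close> applies to the whole vertex set. This is what makes hitting sets
  nonempty.\<close>

lemma plateau_exists:
  assumes "v \<in> verts G"
  shows "\<exists>P. plateau P \<and> verts P \<subseteq> verts G"
proof -
  \<comment> \<open>The inserted 0 keeps \<open>Max\<close> meaningful for a graph without
    arcs.\<close>
  obtain p :: nat where p: "prime p" "p > Max (insert 0 ((\<lambda>e. nat \<bar>lab e\<bar>) ` arcs G))"
    using bigger_prime by blast
  have "\<not> int p dvd lab e" if e: "e \<in> arcs G" for e
  proof
    assume "int p dvd lab e"
    then have "int p \<le> \<bar>lab e\<bar>" using zdvd_imp_le[of "int p" "\<bar>lab e\<bar>"] lab_nonzero[OF e] by simp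
    moreover have "nat \<bar>lab e\<bar> \<le> Max (insert 0 ((\<lambda>e. nat \<bar>lab e\<bar>) ` arcs G))"
      using e by (intro Max_ge) auto
    ultimately show False using p(2) by linarith
  qed
  then show ?thesis using plateau_within[of "verts G" v p] assms p(1) unfolding plateau_def by auto
qed

lemma hitting_set_exists: "\<exists>X\<subseteq>verts G. card X = plateaunic_number \<and> (\<forall>P. plateau P \<longrightarrow> X \<inter> verts P \<noteq> {})"
proof -
  have "verts G \<inter> verts P \<noteq> {}" if "plateau P" for P
    using that unfolding plateau_def p_plateau_def serre_subgraph_def subgraph_def by blast
  then have "\<exists>X\<subseteq>verts G. card X = card (verts G) \<and> (\<forall>P. plateau P \<longrightarrow> X \<inter> verts P \<noteq> {})" by blast
  then show ?thesis unfolding plateaunic_number_def by (rule LeastI[where P = "\<lambda>n. \<exists>X\<subseteq>verts G. card X = n \<and> (\<forall>P. plateau P \<longrightarrow> X \<inter> verts P \<noteq> {})"])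
qed

text \<open>If \<open>n\<close> is not constantly 1, take a prime \<open>p\<close> and the largest \<open>m\<close> such that \<open>p ^ m\<close> divides a
  value of \<open>n\<close>: the vertices where it does contain a \<open>p\<close>-plateau.\<close>

lemma hitting_set_index_one:
  fixes n :: "'v \<Rightarrow> nat"
  assumes conn: "Digraph_Component.connected G"
    and X: "X \<subseteq> verts G" "\<And>P. plateau P \<Longrightarrow> X \<inter> verts P \<noteq> {}" "\<And>x. x \<in> X \<Longrightarrow> n x = 1"
    and rel: "\<And>e k. e \<in> arcs G \<Longrightarrow> int (n (tail G e)) dvd lab e * k \<longleftrightarrow> int (n (head G e)) dvd lab (arev e) * k"
    and v: "v \<in> verts G"
  shows "n v = 1"
proof (rule ccontr)
  assume n1: "n v \<noteq> 1"
  \<comment> \<open>Valuations need nonzero values. By \<open>rel\<close>, a zero spreads across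
    every edge, and the graph is connected, but \<open>n\<close> is 1 on the nonempty set
    \<open>X\<close>.\<close>
  have n0: "n u \<noteq> 0" if "u \<in> verts G" for u
  proof -
    define W where "W = {u \<in> verts G. n u \<noteq> 0}"
    have "W \<noteq> {}" using plateau_exists[OF v] X unfolding W_def by fastforce
    have "W = verts G"
    proof (rule ccontr)
      assume ne: "W \<noteq> verts G"
      have "subgraph G G" using wf_digraph unfolding subgraph_def compatible_def by simp
      then obtain e where e: "e \<in> arcs G" "tail G e \<in> W" "head G e \<notin> W"
        using connected_cut[OF _ arev_in_arcs conn _ \<open>W \<noteq> {}\<close> ne] unfolding W_def by blast
      then have "n (head G e) = 0" unfolding W_def by simp
      then have "lab (arev e) * int (n (tail G e)) = 0" using rel[OF e(1), of "int (n (tail G e))"] by simp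
      then show False using lab_nonzero[of "arev e"] e unfolding W_def by simp
    qed
    then show ?thesis using that unfolding W_def by blast
  qed
  obtain p where p: "prime p" "p dvd n v" using n1 prime_factor_nat by blast
  then have pp: "prime (int p)" by simp
  define D where "D m \<longleftrightarrow> (\<exists>u\<in>verts G. p ^ m dvd n u)" for m
  have bound: "m \<le> Max (n ` verts G)" if "D m" for m
  proof -
    obtain u where u: "u \<in> verts G" "p ^ m dvd n u" using \<open>D m\<close> unfolding D_def by blast
    have "m < p ^ m" using prime_gt_1_nat[OF p(1)] by (intro power_gt_expt) simp
    also have "\<dots> \<le> n u" using u n0 by (intro dvd_imp_le) auto
    also have "\<dots> \<le> Max (n ` verts G)" using u by simp
    finally show ?thesis by simp
  qed
  define m where "m = Greatest D"
  have "D 1" using v p(2) unfolding D_def by auto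
  then have m: "D m" "m \<ge> 1" and mmax: "\<And>m'. D m' \<Longrightarrow> m' \<le> m"
    unfolding m_def using GreatestI_nat[of D 1] Greatest_le_nat[of D] bound by blast+
  define W where "W = {u \<in> verts G. p ^ m dvd n u}"
  obtain u0 where u0: "u0 \<in> W" using m(1) unfolding D_def W_def by blast
  have pm: "int p ^ m = int p * int p ^ (m - 1)" using m(2) by (metis power_eq_if not_one_le_zero)
  have "\<exists>P. p_plateau p P \<and> verts P \<subseteq> W"
  proof (rule plateau_within[OF _ u0])
    fix e assume e: "e \<in> arcs G" "tail G e \<in> W" "\<not> int p dvd lab e"
    have cop: "coprime (int p ^ m) (lab e)" using e(3) pp by (simp add: prime_imp_coprime)
    have pt: "int p ^ m dvd int (n (tail G e))" using e(2) unfolding W_def by (auto simp flip: of_nat_power)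
    \<comment> \<open>Taking \<open>k = n (head G e)\<close> in \<open>rel\<close> moves
      \<open>p ^ m\<close> across an edge whose label is prime to \<open>p\<close>.\<close>
    have "int (n (tail G e)) dvd lab e * int (n (head G e))" using rel[OF e(1)] by simp
    then have ph: "int p ^ m dvd int (n (head G e))"
      using pt cop by (meson coprime_dvd_mult_right_iff dvd_trans)
    then have "head G e \<in> W" using e(1) unfolding W_def by (auto simp flip: of_nat_power)
    moreover have "\<not> int p dvd lab (arev e)"
    proof
      assume "int p dvd lab (arev e)"
      then obtain l where l: "lab (arev e) = int p * l" by blast
      obtain b where b: "int (n (head G e)) = int p ^ m * b" using ph by blast
      \<comment> \<open>If \<open>p\<close> divides the opposite label, an exponent smaller by a
        factor \<open>p\<close> already works at the head. Going back to the tail then forces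
        \<open>p\<close> to divide \<open>b\<close>, against the maximality of
        \<open>m\<close>.\<close>
      have "lab (arev e) * (int p ^ (m - 1) * b) = l * int (n (head G e))"
        unfolding l b pm by (simp add: algebra_simps)
      then have "int (n (tail G e)) dvd lab e * (int p ^ (m - 1) * b)" using rel[OF e(1)] by simp
      then have "int p ^ m dvd int p ^ (m - 1) * b"
        using pt cop by (meson coprime_dvd_mult_right_iff dvd_trans)
      then have "int p dvd b" unfolding pm using prime_gt_0_nat[OF p(1)] by (simp add: mult.commute)
      then have "int p ^ Suc m dvd int (n (head G e))" unfolding b by (simp add: mult_dvd_mono mult.commute)
      then have "p ^ Suc m dvd n (head G e)" by (simp flip: of_nat_power of_nat_mult)
      then have "D (Suc m)" using e(1) unfolding D_def by (intro bexI[of _ "head G e"]) simp_all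
      then show False using mmax by fastforce
    qed
    ultimately show "head G e \<in> W \<and> \<not> int p dvd lab (arev e)" by blast
  qed (auto simp: W_def)
  then obtain P where P: "p_plateau p P" "verts P \<subseteq> W" by blast
  then have "plateau P" using p(1) unfolding plateau_def by blast
  then obtain x where x: "x \<in> X" "x \<in> W" using X(2) P(2) by blast
  then have "p ^ m dvd 1" using X(3) unfolding W_def by auto
  then show False using m(2) prime_gt_1_nat[OF p(1)] by (simp add: power_eq_1_iff)
qed

lemma hitting_set_generates:
  assumes conn: "Digraph_Component.connected G"
    and T: "arcs T \<subseteq> arcs G" and E: "outer_orientation T E"
    and X: "X \<subseteq> verts G" "\<And>P. plateau P \<Longrightarrow> X \<inter> verts P \<noteq> {}"
  shows "generate (fundamental_group T) (vertex_gen T ` X \<union> stable_letter T ` E) = carrier (fundamental_group T)"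
proof -
  interpret F: group "fundamental_group T" by (rule group_fundamental_group)
  let ?F = "fundamental_group T"
  define S where "S = vertex_gen T ` X \<union> stable_letter T ` E"
  define H where "H = generate ?F S"
  have EG: "E \<subseteq> arcs G" using E unfolding outer_orientation_def by blast
  have vc: "word_class T [Elt v k] \<in> carrier ?F" if "v \<in> verts G" for v k
    using that unfolding carrier_fundamental_group gwords_def by (intro imageI) simp
  have ec: "word_class T [Edge e] \<in> carrier ?F" if "e \<in> arcs G" for e
    using that unfolding carrier_fundamental_group gwords_def by (intro imageI) simp
  have S: "S \<subseteq> carrier ?F"
    unfolding S_def vertex_gen_def stable_letter_def using X(1) EG vc ec by blast
  have sub: "subgroup H ?F" unfolding H_def by (rule F.generate_is_subgroup[OF S])
  have mult: "word_class T (w @ w') \<in> H" if "word_class T w \<in> H" "word_class T w' \<in> H" for w w'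
    using subgroup.m_closed[OF sub that] by (simp add: mult_word_class)
  have one: "word_class T [] \<in> H" using subgroup.one_closed[OF sub] by (simp add: one_fundamental_group)
  have edge_inverse: "inv\<^bsub>?F\<^esub> (word_class T [Edge e]) = word_class T [Edge (arev e)]" if "e \<in> arcs G" for e
  proof (rule F.inv_equality)
    show "word_class T [Edge (arev e)] \<otimes>\<^bsub>?F\<^esub> word_class T [Edge e] = \<one>\<^bsub>?F\<^esub>"
      using word_eq.edge_inv[of "arev e" T] that by (simp add: mult_word_class one_fundamental_group word_class_eq_iff)
  qed (use ec that in simp_all)
  have edge_H: "word_class T [Edge e] \<in> H" if e: "e \<in> arcs G" for e
  proof -
    have in_E: "word_class T [Edge d] \<in> H" if "d \<in> E" for d
      using that generate.incl[of "stable_letter T d" S ?F] unfolding H_def S_def stable_letter_def by blast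
    consider "e \<in> arcs T" | "e \<in> E" | "arev e \<in> E"
      using E e unfolding outer_orientation_def by blast
    then show ?thesis
    proof cases
      case 1
      then have "word_class T [Edge e] = word_class T []" using word_eq.tree_edge word_class_eq_iff by blast
      then show ?thesis using one by simp
    next
      case 3
      then show ?thesis using subgroup.m_inv_closed[OF sub in_E[OF 3]] edge_inverse[of "arev e"] e by simp
    qed (rule in_E)
  qed
  \<comment> \<open>The exponents of the powers of the vertex generator lying in \<open>H\<close>.
    Conjugation by stable letters, all of which are in \<open>H\<close>, yields the relation between
    their generators \<open>n\<close> at the two ends of an edge.\<close>
  define I where "I v = {k. word_class T [Elt v k] \<in> H}" for v
  have "\<exists>n::nat. I v = {k. int n dvd k}" if v: "v \<in> verts G" for v
  proof (rule int_subgroup_principal)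
    show "0 \<in> I v" using one word_eq.elt_one[OF v, of T] word_class_eq_iff[of T "[Elt v 0]" "[]"] unfolding I_def by simp
    fix i j assume ij: "i \<in> I v" "j \<in> I v"
    have "inv\<^bsub>?F\<^esub> (word_class T [Elt v j]) = word_class T [Elt v (- j)]"
    proof (rule F.inv_equality)
      show "word_class T [Elt v (- j)] \<otimes>\<^bsub>?F\<^esub> word_class T [Elt v j] = \<one>\<^bsub>?F\<^esub>"
        using word_eq.trans[OF word_eq.elt_mult[OF v, of "- j" j T]] word_eq.elt_one[OF v, of T]
        by (simp add: mult_word_class one_fundamental_group word_class_eq_iff)
    qed (use vc v in simp_all)
    then have "word_class T [Elt v (- j)] \<in> H"
      using subgroup.m_inv_closed[OF sub] ij(2) unfolding I_def by (metis mem_Collect_eq)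
    then have "word_class T ([Elt v i] @ [Elt v (- j)]) \<in> H" using mult ij(1) unfolding I_def by blast
    moreover have "word_class T [Elt v i, Elt v (- j)] = word_class T [Elt v (i - j)]"
      using word_eq.elt_mult[OF v, of i "- j" T] by (simp add: word_class_eq_iff)
    ultimately show "i - j \<in> I v" unfolding I_def by simp
  qed
  then have "\<forall>v. \<exists>n::nat. v \<in> verts G \<longrightarrow> I v = {k. int n dvd k}" by blast
  from choice[OF this] obtain n :: "'v \<Rightarrow> nat" where n: "\<And>v. v \<in> verts G \<Longrightarrow> I v = {k. int (n v) dvd k}" by blast
  have move: "lab (arev e) * k \<in> I (head G e)" if "e \<in> arcs G" "lab e * k \<in> I (tail G e)" for e k
  proof -
    have "word_class T ([Edge e] @ [Elt (tail G e) (lab e * k)] @ [Edge (arev e)]) \<in> H"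
      using that edge_H[OF that(1)] edge_H[of "arev e"] unfolding I_def by (intro mult) simp_all
    moreover have "word_class T [Edge e, Elt (tail G e) (lab e * k), Edge (arev e)]
        = word_class T [Elt (head G e) (lab (arev e) * k)]"
      using word_eq.edge_conj[OF that(1), of k T] that(1) by (simp add: word_class_eq_iff)
    ultimately show ?thesis unfolding I_def by simp
  qed
  have n1: "n v = 1" if "v \<in> verts G" for v
  proof (rule hitting_set_index_one[OF conn X(1) X(2) _ _ that])
    fix x assume x: "x \<in> X"
    then have "1 \<in> I x"
      using generate.incl[of "vertex_gen T x" S ?F] unfolding I_def H_def S_def vertex_gen_def by simp
    then show "n x = 1" using n x X(1) by auto
  next
    fix e k assume e: "e \<in> arcs G"
    show "int (n (tail G e)) dvd lab e * k \<longleftrightarrow> int (n (head G e)) dvd lab (arev e) * k"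
      using move[OF e, of k] move[of "arev e" k] n[of "tail G e"] n[of "head G e"] e by auto
  qed
  have "word_class T w \<in> H" if "w \<in> gwords" for w
    using that
  proof (induction w)
    case Nil
    show ?case by (rule one)
  next
    case (Cons l w)
    then have l: "valid_letter l" "w \<in> gwords" unfolding gwords_def by simp_all
    have "word_class T [l] \<in> H"
    proof (cases l)
      case (Elt v k)
      then have "v \<in> verts G" using l(1) by simp
      then show ?thesis using n n1 Elt unfolding I_def by auto
    next
      case (Edge e)
      then show ?thesis using edge_H l(1) by simp
    qed
    then show ?case using mult[of "[l]" w] Cons.IH[OF l(2)] by simp
  qed
  then have "carrier ?F \<subseteq> H" unfolding carrier_fundamental_group by blast
  then show ?thesis using F.generate_incl[OF S] unfolding H_def S_def by blast
qed

lemma rank_via_subtree: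
  fixes H :: "('g, 'm) monoid_scheme"
  assumes conn: "Digraph_Component.connected G" and T: "maximal_subtree T"
    and E: "outer_orientation T E" and H: "group H" and \<phi>: "\<phi> \<in> iso (fundamental_group T) H"
  shows "group_rank H = first_betti_number + plateaunic_number"
    and "\<exists>S \<subseteq> \<phi> ` (vertex_gen T ` verts G \<union> stable_letter T ` E). finite S
      \<and> generate H S = carrier H \<and> card S = group_rank H"
proof -
  interpret F: group "fundamental_group T" by (rule group_fundamental_group)
  interpret \<phi>: group_hom "fundamental_group T" H \<phi>
    using H \<phi> by (simp add: group_hom_def group_hom_axioms_def F.is_group iso_def)
  let ?F = "fundamental_group T"
  have bij: "bij_betw \<phi> (carrier ?F) (carrier H)" using \<phi> by (simp add: iso_def)
  have g: "grown (verts G) (arcs T)" by (rule maximal_subtree_grown[OF conn finite_verts T])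
  have E': "E \<subseteq> arcs G - arcs T" "\<And>e. e \<in> arcs G - arcs T \<Longrightarrow> (e \<in> E) \<noteq> (arev e \<in> E)"
    using E unfolding outer_orientation_def by blast+
  have TG: "arcs T \<subseteq> arcs G" using grown_subset[OF g] by blast
  have betti: "first_betti_number = card E" by (rule betti_grown[OF finite_arcs g E'])
  have "card (arcs G - arcs T) = 2 * card E"
  proof (rule card_orientation[OF _ _ E'])
    fix e assume "e \<in> arcs G - arcs T"
    then show "arev e \<in> arcs G - arcs T" using grown_arcs[OF g, of "arev e"] by auto
  qed simp
  then have arcs: "card (arcs G) + 2 = 2 * card E + 2 * card (verts G)"
    using grown_card[OF g] TG card_mono[OF finite_arcs TG] by (simp add: card_Diff_subset finite_subset)
  have lower: "card E + plateaunic_number \<le> card S"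
    if S: "S \<subseteq> carrier H" "finite S" "generate H S = carrier H" for S
  proof -
    \<comment> \<open>Generating sets of \<open>H\<close> are pulled back to the fundamental group,
      where the lower bound was proved.\<close>
    define S' where "S' = inv_into (carrier ?F) \<phi> ` S"
    have surj: "S \<subseteq> \<phi> ` carrier ?F" using S(1) bij unfolding bij_betw_def by simp
    then have S': "S' \<subseteq> carrier ?F" unfolding S'_def by (auto intro: inv_into_into)
    have "\<phi> ` S' = S" unfolding S'_def by (rule image_inv_into_cancel[OF HOL.refl surj])
    have "\<phi> ` generate ?F S' = \<phi> ` carrier ?F"
      using \<phi>.generate_img[OF S'] \<open>\<phi> ` S' = S\<close> S(3) bij unfolding bij_betw_def by simp
    then have "generate ?F S' = carrier ?F"
      using F.generate_incl[OF S'] bij unfolding bij_betw_def by (meson inj_on_image_eq_iff order_refl)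
    then have "card (arcs G) + 2 * plateaunic_number + 2 \<le> 2 * card S' + 2 * card (verts G)"
      using S(2) S' by (intro generating_set_lower_bound[OF g]) (simp_all add: S'_def)
    moreover have "card S' \<le> card S" unfolding S'_def by (rule card_image_le[OF S(2)])
    ultimately show ?thesis using arcs by linarith
  qed
  obtain X where X: "X \<subseteq> verts G" "card X = plateaunic_number" "\<And>P. plateau P \<Longrightarrow> X \<inter> verts P \<noteq> {}"
    using hitting_set_exists by blast
  define Y where "Y = vertex_gen T ` X \<union> stable_letter T ` E"
  have finX: "finite X" and finE: "finite E"
    using X(1) E'(1) finite_subset[OF _ finite_verts] finite_subset[OF _ finite_arcs] by blast+
  have Y: "generate ?F Y = carrier ?F"
    unfolding Y_def by (rule hitting_set_generates[OF conn TG E X(1,3)])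
  have Yc: "Y \<subseteq> carrier ?F" using Y generate.incl[of _ Y ?F] by blast
  have gen: "generate H (\<phi> ` Y) = carrier H"
    using \<phi>.generate_img[OF Yc] Y bij unfolding bij_betw_def by simp
  have Ysub: "\<phi> ` Y \<subseteq> carrier H" using Yc by auto
  have finY: "finite (\<phi> ` Y)" using finX finE unfolding Y_def by simp
  have "card (\<phi> ` Y) \<le> card Y" using finX finE unfolding Y_def by (intro card_image_le) simp
  also have "\<dots> \<le> card (vertex_gen T ` X) + card (stable_letter T ` E)"
    unfolding Y_def by (rule card_Un_le)
  also have "\<dots> \<le> card X + card E" using finX finE by (intro add_mono card_image_le)
  \<comment> \<open>That the chosen generators are distinct needs no separate argument: a
    coincidence would contradict the lower bound.\<close>
  finally have card: "card (\<phi> ` Y) = card E + plateaunic_number"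
    using lower[OF Ysub finY gen] X(2) by simp
  have rank: "group_rank H = card E + plateaunic_number"
    unfolding group_rank_def
  proof (rule Least_equality)
    show "\<exists>S. S \<subseteq> carrier H \<and> finite S \<and> card S = card E + plateaunic_number \<and> generate H S = carrier H"
      using Ysub finY gen card by blast
  qed (use lower in blast)
  then show "group_rank H = first_betti_number + plateaunic_number" using betti by simp
  have "\<phi> ` Y \<subseteq> \<phi> ` (vertex_gen T ` verts G \<union> stable_letter T ` E)" using X(1) unfolding Y_def by blast
  then show "\<exists>S \<subseteq> \<phi> ` (vertex_gen T ` verts G \<union> stable_letter T ` E). finite S
      \<and> generate H S = carrier H \<and> card S = group_rank H"
    using finY gen card rank by (intro exI[of _ "\<phi> ` Y"]) simp
qed

end

theorem theorem3p2:
  fixes \<Gamma> :: "('v, 'e) pre_digraph"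
    and arev :: "'e \<Rightarrow> 'e"
    and lab :: "'e \<Rightarrow> int"
    and G :: "('g, 'm) monoid_scheme"
  assumes "labelled_graph \<Gamma> arev lab"
    and "Digraph_Component.connected \<Gamma>"
    and "labelled_graph.represents_gbs \<Gamma> arev lab G"
  shows "(\<forall>X. labelled_graph.standard_generating_set \<Gamma> arev lab G X \<longrightarrow>
           (\<exists>S. S \<subseteq> X \<and> finite S \<and> generate G S = carrier G \<and> card S = group_rank G))
       \<and> group_rank G = bidirected_digraph.first_betti_number \<Gamma> arev
           + labelled_graph.plateaunic_number \<Gamma> arev lab"
proof -
  interpret labelled_graph \<Gamma> arev lab by (rule assms(1))
  obtain T where G: "group G" and T: "maximal_subtree T" "fundamental_group T \<cong> G"
    using assms(3) unfolding represents_gbs_def by blast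
  then obtain \<phi> where \<phi>: "\<phi> \<in> iso (fundamental_group T) G" unfolding is_iso_def by blast
  have g: "grown (verts \<Gamma>) (arcs T)" by (rule maximal_subtree_grown[OF assms(2) finite_verts T(1)])
  \<comment> \<open>The representing isomorphism supplies a maximal subtree but no orientation of
    the remaining edges, so one is chosen for the rank formula.\<close>
  have "\<exists>E. E \<subseteq> arcs \<Gamma> - arcs T \<and> (\<forall>e\<in>arcs \<Gamma> - arcs T. (e \<in> E) \<noteq> (arev e \<in> E))"
  proof (rule orientation_exists)
    fix e assume e: "e \<in> arcs \<Gamma> - arcs T"
    then show "arev e \<in> arcs \<Gamma> - arcs T" using grown_arcs[OF g, of "arev e"] by auto
    show "arev e \<noteq> e" using e arev_neq by blast
  qed simp
  then obtain E where "outer_orientation T E" unfolding outer_orientation_def by blast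
  then have "group_rank G = first_betti_number + plateaunic_number"
    using rank_via_subtree(1)[OF assms(2) T(1) _ G \<phi>] by blast
  moreover have "\<exists>S. S \<subseteq> X \<and> finite S \<and> generate G S = carrier G \<and> card S = group_rank G"
    if "standard_generating_set G X" for X
    using that rank_via_subtree(2)[OF assms(2) _ _ G] unfolding standard_generating_set_def by metis
  ultimately show ?thesis by blast
qed

end
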